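(* Let $\Gamma$ be a finite simple graph on $V=\{1,\dots,n\}$ and $I$ its edge ideal in $R=k[x_1,\dots,x_n]$, where $k$ is a field. Let $F\subseteq V$ be such that $P_F=(x_i\mid i\in F)\in \mathrm{Ass}^\infty(I)$. Then, for every integer $t\ge 1$, $P_F\in\mathrm{Ass}(I^t)$ if and only if $t>s(\Gamma_{c(F)})$.
   Context: The edge ideal of $\Gamma$ is generated by the monomials $x_ix_j$ with $\{i,j\}$ an edge of $\Gamma$. $\mathrm{Ass}(I^t)$ is the set of associated primes of $R/I^t$. By a theorem of Brodmann, $\mathrm{Ass}(I^t)$ is constant for $t$ large; $\mathrm{Ass}^\infty(I)$ denotes this stable set. Every associated prime of $I^t$ is of the form $P_F$ with $F$ a (vertex) cover of $\Gamma$, i.e. a subset of $V$ meeting every edge. For a cover $F$, the core $c(F)$ is the set of vertices of $F$ not adjacent to any vertex of $V\setminus F$; one has $c(F)=\emptyset$ if and only if $F$ is a minimal cover. $\Gamma_U$ denotes the induced subgraph on $U$. A dominating set of a graph $G$ is a set $U$ of vertices of $G$ such that every vertex of $G$ lies in $U$ or is adjacent to a vertex of $U$. A graph is strongly non-bipartite if each of its connected components contains an odd cycle. A generalized ear decomposition of a connected graph is a finite sequence of walks in the graph, each without repetition of vertices other than its endpoints (so each walk is a path of length at least 1, a cycle, or a closed walk $i,j,i$ of length 2 along an edge), such that the first walk is closed, the endpoints of each subsequent walk are the only vertices of that walk belonging to earlier walks, and the walks pass through all vertices of the graph. An odd-beginning generalized ear decomposition of a strongly non-bipartite graph is a family of generalized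 ear decompositions, one of each connected component, each of whose first walk is an odd cycle. For a strongly non-bipartite graph $G$ with $m$ vertices and $c$ connected components, $\varphi^*(G)$ is the minimal total number of walks of even length in an odd-beginning generalized ear decomposition of $G$, and $\mu^*(G):=(\varphi^*(G)+m-c)/2$. If $F$ is a minimal cover, put $s(\Gamma_{c(F)}):=0$. If $F$ is not a minimal cover, $s(\Gamma_{c(F)})$ is the minimum of $\mu^*(\Gamma_U)$ over all dominating sets $U$ of $\Gamma_{c(F)}$ such that $\Gamma_U$ is strongly non-bipartite (when $P_F\in\mathrm{Ass}^\infty(I)$ such $U$ exist). *)

theory Defs
  imports Complex_Main "HOL-Library.Poly_Mapping" "HOL-Algebra.Algebra"
    "HOL-Algebra.Algebraic_Closure_Type"
begin

section \<open>Associated primes of powers of ideals\<close>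

text \<open>The set $\mathrm{Ass}(R/J)$: the prime ideals of $R$ that are annihilators of
  elements of $R/J$, where $r$ acts on $R/J$ through its residue class.\<close>

definition associated_primes :: "('a, 'b) ring_scheme \<Rightarrow> 'a set \<Rightarrow> 'a set set" where
  "associated_primes R J =
     {P. primeideal P R \<and>
         (\<exists>x \<in> carrier (R Quot J).
            P = {r \<in> carrier R. (J +>\<^bsub>R\<^esub> r) \<otimes>\<^bsub>R Quot J\<^esub> x = \<zero>\<^bsub>R Quot J\<^esub>})}"

text \<open>Ideals form a monoid under the ideal product, with unit the whole ring; powers of
  ideals are powers in this monoid.\<close>

definition ideal_power :: "('a, 'b) ring_scheme \<Rightarrow> 'a set \<Rightarrow> nat \<Rightarrow> 'a set" where
  "ideal_power R I t = I [^]\<^bsub>ideals_set R\<^esub> t"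

text \<open>The set $\mathrm{Ass}^\infty(I)$: a prime belongs to it iff it belongs to the value \<open>A\<close> at
  which the sequence $\mathrm{Ass}(R/I^t)$ becomes constant. There is at most one such \<open>A\<close>, and
  in a Noetherian ring there is exactly one, by Brodmann's theorem.\<close>

definition stable_associated_primes :: "('a, 'b) ring_scheme \<Rightarrow> 'a set \<Rightarrow> 'a set set" where
  "stable_associated_primes R I =
     {P. \<exists>A. (\<exists>t0. \<forall>t \<ge> t0. associated_primes R (ideal_power R I t) = A) \<and> P \<in> A}"


section \<open>Simple graphs\<close>

record 'v ugraph =
  verts :: "'v set"
  edges :: "'v set set"

definition simple_graph :: "'v ugraph \<Rightarrow> bool" where
  "simple_graph G \<longleftrightarrow> finite (verts G) \<and> (\<forall>e \<in> edges G. e \<subseteq> verts G \<and> card e = 2)"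

definition induced_subgraph :: "'v ugraph \<Rightarrow> 'v set \<Rightarrow> 'v ugraph" where
  "induced_subgraph G U = \<lparr>verts = U, edges = {e \<in> edges G. e \<subseteq> U}\<rparr>"

definition vertex_cover :: "'v ugraph \<Rightarrow> 'v set \<Rightarrow> bool" where
  "vertex_cover G F \<longleftrightarrow> F \<subseteq> verts G \<and> (\<forall>e \<in> edges G. e \<inter> F \<noteq> {})"

definition minimal_cover :: "'v ugraph \<Rightarrow> 'v set \<Rightarrow> bool" where
  "minimal_cover G F \<longleftrightarrow> vertex_cover G F \<and> (\<forall>F'. F' \<subset> F \<longrightarrow> \<not> vertex_cover G F')"

definition core :: "'v ugraph \<Rightarrow> 'v set \<Rightarrow> 'v set" where
  "core G F = {v \<in> F. \<forall>u \<in> verts G - F. {u, v} \<notin> edges G}"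

definition dominating_set :: "'v ugraph \<Rightarrow> 'v set \<Rightarrow> bool" where
  "dominating_set G U \<longleftrightarrow>
     U \<subseteq> verts G \<and> (\<forall>v \<in> verts G. v \<in> U \<or> (\<exists>u \<in> U. {u, v} \<in> edges G))"

definition components :: "'v ugraph \<Rightarrow> 'v set set" where
  "components G =
     verts G // {(u, v) \<in> verts G \<times> verts G. (u, v) \<in> {(a, b). {a, b} \<in> edges G}\<^sup>*}"


section \<open>Ear decompositions\<close>

text \<open>A walk $v_0, \dots, v_l$ with $l \ge 1$ is the list of its vertices. The vertices
  $v_0, \dots, v_{l-1}$ are distinct, and so are $v_1, \dots, v_l$: only $v_0 = v_l$ is allowed.
  In particular $[i, j, i]$ is allowed.\<close>

definition ear :: "'v ugraph \<Rightarrow> 'v list \<Rightarrow> bool" where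
  "ear G w \<longleftrightarrow> 2 \<le> length w \<and> successively (\<lambda>u v. {u, v} \<in> edges G) w \<and>
     distinct (butlast w) \<and> distinct (tl w)"

definition walk_length :: "'v list \<Rightarrow> nat" where
  "walk_length w = length w - 1"

definition closed_walk :: "'v list \<Rightarrow> bool" where
  "closed_walk w \<longleftrightarrow> hd w = last w"

definition odd_cycle :: "'v ugraph \<Rightarrow> 'v list \<Rightarrow> bool" where
  "odd_cycle G w \<longleftrightarrow> ear G w \<and> closed_walk w \<and> 3 \<le> walk_length w \<and> odd (walk_length w)"

definition strongly_non_bipartite :: "'v ugraph \<Rightarrow> bool" where
  "strongly_non_bipartite G \<longleftrightarrow>
     (\<forall>C \<in> components G. \<exists>w. odd_cycle (induced_subgraph G C) w)"

definition generalized_ear_decomposition :: "'v ugraph \<Rightarrow> 'v list list \<Rightarrow> bool" where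
  "generalized_ear_decomposition G ws \<longleftrightarrow>
     ws \<noteq> [] \<and> (\<forall>w \<in> set ws. ear G w) \<and> closed_walk (hd ws) \<and>
     (\<forall>k. 0 < k \<and> k < length ws \<longrightarrow>
        set (ws ! k) \<inter> (\<Union>j<k. set (ws ! j)) = {hd (ws ! k), last (ws ! k)}) \<and>
     (\<Union>w \<in> set ws. set w) = verts G"

text \<open>A family of decompositions is indexed by the vertex sets of the connected components;
  its values elsewhere are irrelevant.\<close>

definition odd_beginning_ear_decomposition ::
    "'v ugraph \<Rightarrow> ('v set \<Rightarrow> 'v list list) \<Rightarrow> bool" where
  "odd_beginning_ear_decomposition G D \<longleftrightarrow>
     (\<forall>C \<in> components G.
        generalized_ear_decomposition (induced_subgraph G C) (D C) \<and>
        odd_cycle (induced_subgraph G C) (hd (D C)))"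

definition num_even_walks :: "'v ugraph \<Rightarrow> ('v set \<Rightarrow> 'v list list) \<Rightarrow> nat" where
  "num_even_walks G D =
     (\<Sum>C \<in> components G. length (filter (\<lambda>w. even (walk_length w)) (D C)))"

definition phi_star :: "'v ugraph \<Rightarrow> nat" where
  "phi_star G = (LEAST k. \<exists>D. odd_beginning_ear_decomposition G D \<and> num_even_walks G D = k)"

definition mu_star :: "'v ugraph \<Rightarrow> real" where
  "mu_star G =
     (real (phi_star G) + real (card (verts G)) - real (card (components G))) / 2"

text \<open>The number $s(\Gamma_{c(F)})$.\<close>

definition s_core :: "'v ugraph \<Rightarrow> 'v set \<Rightarrow> real" where
  "s_core G F =
     (if minimal_cover G F then 0
      else Min {mu_star (induced_subgraph G U) | U.
             dominating_set (induced_subgraph G (core G F)) U \<and>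
             strongly_non_bipartite (induced_subgraph G U)})"


section \<open>Edge ideals\<close>

text \<open>Polynomials over \<open>'k\<close> in the variables $x_i$, $i \in$ \<open>'v\<close>, are finitely supported
  functions from exponent vectors to coefficients.\<close>

type_synonym ('v, 'k) mpolynomial = "('v \<Rightarrow>\<^sub>0 nat) \<Rightarrow>\<^sub>0 'k"

abbreviation mpolynomial_ring :: "('v, 'k::field) mpolynomial ring" where
  "mpolynomial_ring \<equiv> ring_of_type_algebra"

definition indet :: "'v \<Rightarrow> ('v, 'k::field) mpolynomial" where
  "indet i = Poly_Mapping.single (Poly_Mapping.single i 1) 1"

definition var_ideal :: "'v set \<Rightarrow> ('v, 'k::field) mpolynomial set" where
  "var_ideal F = Idl\<^bsub>mpolynomial_ring\<^esub> (indet ` F)"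

definition edge_ideal :: "'v ugraph \<Rightarrow> ('v, 'k::field) mpolynomial set" where
  "edge_ideal G = Idl\<^bsub>mpolynomial_ring\<^esub> {indet i * indet j | i j. {i, j} \<in> edges G}"

end

theory Submission
  imports Defs "HOL-Library.Multiset"
begin

text \<open>Monomials are multisets of vertices, and a monomial lies in $I^t$ iff it contains the vertices
  of a matching with $t$ edges, where a vertex may be used as often as it occurs. Since every edge
  meets $F$ and every vertex of $F$ outside the core has a neighbour outside $F$, the prime $P_F$ is
  associated to $I^t$ iff (up to the part of the monomial outside the core) there is a weight $a$ on
  the core with matching number below $t$ that increases when any vertex of the core is added to
  $a$. Deleting from $a$ the vertices covered by all maximum matchings keeps this property, and by
  Gallai's lemma the restrictions of the remaining weight to the components of its support $U$ are
  factor-critical; the support dominates the core because every vertex has a neighbour that is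
  missed by some maximum matching. Lovasz' odd ear decomposition of a factor-critical weight
  projects to walks in the graph, and cutting these into ears costs at most one unit of excess
  weight for each even ear. Conversely, an even ear becomes an odd one when one endpoint is doubled,
  so an ear decomposition of a component on $m$ vertices with $e$ even ears yields a
  factor-critical weight of total size $m + e$. Hence the least possible matching number of $a$ is the
  minimum of $\mu^*$.\<close>

section \<open>Matchings with multiplicities\<close>

text \<open>The shape of \<open>mu_star\<close> comes from parity: a factor-critical weight of size
  N has odd N and matching number (N - 1)/2. Hence such weights on the c components of an induced
  subgraph, of total size m + phi, have joint matching number (phi + m - c)/2. Every larger matching
  number is reached too, since copies of the two ends of one edge raise it by one and keep a weight
  factor-critical; so the associated powers form an upward closed set of t. A matching is remembered
  only through the copies it covers, so the classical exchange arguments run on weights directly,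
  without splitting vertices. The price is that an alternating walk may visit a vertex of the graph
  several times, which an ear may not; cutting such walks loses size, and the ear statements
  therefore carry an inequality n + card S \<le> size a. The core appears because variables outside
  F act as units: every copy of a vertex of F outside the core can be matched to a neighbour outside
  F at no cost and merely shifts t. Membership in Ass^infinity enters through one power having P_F
  as an associated prime: it makes P_F prime, F a cover and the minimum one over a nonempty
  set.\<close>

lemma filter_mset_eq_emptyI: "(\<And>x. x \<in># M \<Longrightarrow> \<not> P x) \<Longrightarrow> filter_mset P M = {#}"
  by (induction M) auto

lemma add_mset_subseteq_iff:
  "add_mset x p \<subseteq># a \<longleftrightarrow> p \<subseteq># a \<and> count p x < count a x"
proof
  assume "add_mset x p \<subseteq># a"
  then have *: "count (add_mset x p) z \<le> count a z" for z by (rule mset_subset_eq_count)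
  have "count p z \<le> count a z" for z using *[of z] by (simp split: if_splits)
  then show "p \<subseteq># a \<and> count p x < count a x"
    using *[of x] by (simp add: subseteq_mset_def)
next
  assume "p \<subseteq># a \<and> count p x < count a x"
  then show "add_mset x p \<subseteq># a" by (simp add: subseteq_mset_def)
qed

lemma sum_size_filter_partition:
  assumes "finite K" and "\<And>x. x \<in># a \<Longrightarrow> \<exists>!A. A \<in> K \<and> x \<in> A"
  shows "(\<Sum>A\<in>K. size (filter_mset (\<lambda>x. x \<in> A) a)) = size a"
  using assms(2)
proof (induction a)
  case (add x a)
  obtain A where A: "A \<in> K" "x \<in> A" "\<And>B. B \<in> K \<Longrightarrow> x \<in> B \<Longrightarrow> B = A"
    using add.prems[of x] by auto
  have "(\<Sum>B\<in>K. size (filter_mset (\<lambda>y. y \<in> B) (add_mset x a))) =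
      (\<Sum>B\<in>K. (if B = A then 1 else 0) + size (filter_mset (\<lambda>y. y \<in> B) a))"
  proof (rule sum.cong[OF refl])
    fix B assume "B \<in> K"
    with A have "x \<in> B \<longleftrightarrow> B = A" by blast
    then show "size (filter_mset (\<lambda>y. y \<in> B) (add_mset x a)) =
        (if B = A then 1 else 0) + size (filter_mset (\<lambda>y. y \<in> B) a)"
      by simp
  qed
  also have "\<dots> = 1 + size a"
    using assms(1) A(1) add.IH add.prems by (simp add: sum.distrib)
  finally show ?case by simp
qed simp

text \<open>A set of edges with multiplicities is recorded by the multiset of its endpoints.\<close>

inductive matched :: "'v set set \<Rightarrow> 'v multiset \<Rightarrow> bool" for E where
  empty: "matched E {#}"
| add: "matched E p \<Longrightarrow> {x, y} \<in> E \<Longrightarrow> matched E (add_mset x (add_mset y p))"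

lemma matched_even: "matched E p \<Longrightarrow> even (size p)"
  by (induction rule: matched.induct) auto

text \<open>The edges may be added in any order, so an edge at \<open>x\<close> can be taken to be
  the last one.\<close>

lemma matched_removeE:
  assumes "matched E p" and "x \<in># p"
  obtains y q where "p = add_mset x (add_mset y q)" and "{x, y} \<in> E" and "matched E q"
proof -
  have "\<exists>y q. p = add_mset x (add_mset y q) \<and> {x, y} \<in> E \<and> matched E q"
    using assms
  proof (induction arbitrary: x rule: matched.induct)
    case (add p a b)
    consider "x = a" | "x = b" | "x \<noteq> a" "x \<noteq> b" "x \<in># p"
      using add.prems by auto
    then show ?case
    proof cases
      case 1
      then show ?thesis using add by blast
    next
      case 2
      then show ?thesis using add by (metis add_mset_commute insert_commute)
    next
      case 3
      then obtain y q where "p = add_mset x (add_mset y q)" "{x, y} \<in> E" "matched E q"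
        using add.IH by blast
      then show ?thesis
        by (intro exI[of _ y] exI[of _ "add_mset a (add_mset b q)"])
           (auto simp: add.hyps intro: matched.add)
    qed
  qed simp
  then show thesis using that by blast
qed

lemma matched_union: "matched E p \<Longrightarrow> matched E q \<Longrightarrow> matched E (p + q)"
  by (induction rule: matched.induct) (auto intro: matched.intros)

lemma matched_sum: "(\<And>x. x \<in> A \<Longrightarrow> matched E (f x)) \<Longrightarrow> matched E (\<Sum>x\<in>A. f x)"
  by (induction A rule: infinite_finite_induct) (auto intro: matched.empty matched_union)

lemma matched_mono: "matched E p \<Longrightarrow> E \<subseteq> E' \<Longrightarrow> matched E' p"
  by (induction rule: matched.induct) (auto intro: matched.intros)

lemma matched_filter:
  assumes "matched E p"
    and "\<And>x y. {x, y} \<in> E \<Longrightarrow> x \<in># p \<Longrightarrow> y \<in># p \<Longrightarrow> P x \<longleftrightarrow> P y"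
  shows "matched E (filter_mset P p)"
  using assms by (induction rule: matched.induct) (auto intro: matched.intros)

text \<open>Follow an alternating trail from \<open>v\<close>, starting with an edge of
  \<open>p\<close>. If it stops after an edge of \<open>q\<close>, switching \<open>p\<close> along
  it trades \<open>v\<close> for the end \<open>u\<close>; if it stops after an edge of
  \<open>p\<close>, switching \<open>q\<close> along it gains both ends. The induction removes one
  edge of \<open>p\<close> and one of \<open>q\<close> and goes on from the vertex reached.\<close>

lemma matched_exchange:
  assumes loopless: "\<And>x. {x} \<notin> E"
    and "matched E p" "matched E q" "count q v < count p v"
  shows "(\<exists>u. count p u < count q u \<and> matched E (add_mset u (p - {#v#}))) \<or>
    (\<exists>u. matched E (add_mset v (add_mset u q)) \<and> add_mset v (add_mset u q) \<subseteq># p \<union># q)"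
  using assms(2-)
proof (induction "size p" arbitrary: p q v rule: less_induct)
  case less
  have "v \<in># p"
    using less.prems(3) by (metis count_inI not_less0)
  then obtain x p1 where p: "p = add_mset v (add_mset x p1)" "{v, x} \<in> E" "matched E p1"
    using matched_removeE[OF less.prems(1)] by metis
  have vx: "v \<noteq> x"
    using p(2) loopless[of v] by auto
  show ?case
  proof (cases "count p1 x < count q x")
    case False
    have "matched E (add_mset v (add_mset x q))"
      using less.prems(2) p(2) by (rule matched.add)
    moreover have "add_mset v (add_mset x q) \<subseteq># p \<union># q"
      using False less.prems(3) vx by (auto simp: subseteq_mset_def p(1))
    ultimately show ?thesis by blast
  next
    case True
    then have "x \<in># q" by (metis count_inI not_less0)
    then obtain y q1 where q: "q = add_mset x (add_mset y q1)" "{x, y} \<in> E" "matched E q1"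
      using matched_removeE[OF less.prems(2)] by metis
    have xy: "x \<noteq> y"
      using q(2) loopless[of x] by auto
    \<comment> \<open>Thus in the recursive step \<open>u\<close> cannot be \<open>v\<close> if the
      trail trades, and the new copy of \<open>v\<close> stays below its count in \<open>p\<close>
      if the trail gains.\<close>
    have q1v: "count q1 v \<le> count p1 v"
      using less.prems(3) vx by (auto simp: p q split: if_splits)
    show ?thesis
    proof (cases "count q1 y < count p1 y")
      case False
      then have "count p y < count q y"
        using xy less.prems(3) vx by (auto simp: p q)
      moreover have "matched E (add_mset y (p - {#v#}))"
        using matched.add[OF p(3) q(2)] by (simp add: p add_mset_commute)
      ultimately show ?thesis by blast
    next
      case True
      then have y: "y \<in># p1" by (metis count_inI not_less0)
      have "size p1 < size p" by (simp add: p)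
      from less.hyps[OF this p(3) q(3) True] show ?thesis
      proof (elim disjE exE conjE)
        fix u assume u: "count p1 u < count q1 u" "matched E (add_mset u (p1 - {#y#}))"
        have "count p u < count q u"
          using u(1) q1v by (auto simp: p q)
        moreover have "matched E (add_mset u (p - {#v#}))"
        proof -
          have "add_mset x (add_mset y (add_mset u (p1 - {#y#}))) = add_mset u (p - {#v#})"
            using y by (simp add: p add_mset_commute)
          then show ?thesis
            using matched.add[OF u(2) q(2)] by metis
        qed
        ultimately show ?thesis by blast
      next
        fix u assume u: "matched E (add_mset y (add_mset u q1))"
          "add_mset y (add_mset u q1) \<subseteq># p1 \<union># q1"
        have "matched E (add_mset v (add_mset u q))"
          using matched.add[OF u(1) p(2)] by (simp add: q add_mset_commute)
        moreover have "add_mset v (add_mset u q) \<subseteq># p \<union># q"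
          unfolding subseteq_mset_def
        proof
          fix z
          have "count (add_mset y (add_mset u q1)) z \<le> count (p1 \<union># q1) z"
            using u(2) by (rule mset_subset_eq_count)
          then show "count (add_mset v (add_mset u q)) z \<le> count (p \<union># q) z"
            using q1v vx xy by (auto simp: p q split: if_splits)
        qed
        ultimately show ?thesis by blast
      qed
    qed
  qed
qed

text \<open>Follows edges of \<open>p2\<close> and \<open>q\<close> alternately from \<open>v\<close>; every second edge, starting with
  the first, is an edge of \<open>p2\<close>, so the vertices before the last one are matched.\<close>

lemma matched_alternating_walk:
  assumes "matched E p2" and "matched E q"
    and "add_mset r (p1 + p2) = add_mset v q"
  obtains w y where "odd (length w)" "hd w = v" "last w = y" "successively (\<lambda>u v. {u, v} \<in> E) w"
    "y = r \<or> y \<in># p1" "mset (butlast w) \<subseteq># p2" "matched E (p2 - mset (butlast w))"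
    "matched E (mset (butlast w))"
proof -
  have "\<exists>w y. odd (length w) \<and> hd w = v \<and> last w = y \<and> successively (\<lambda>u v. {u, v} \<in> E) w \<and>
    (y = r \<or> y \<in># p1) \<and> mset (butlast w) \<subseteq># p2 \<and> matched E (p2 - mset (butlast w)) \<and>
    matched E (mset (butlast w))"
    using assms
  proof (induction "size p2" arbitrary: p2 q v rule: less_induct)
    case less
    show ?case
    proof (cases "v = r \<or> v \<in># p1")
      case True
      then show ?thesis
        using less.prems(1) matched.empty by (intro exI[of _ "[v]"] exI[of _ v]) auto
    next
      case False
      have "v \<in># add_mset r (p1 + p2)" using less.prems(3) by simp
      with False have "v \<in># p2" by auto
      then obtain x p3 where p: "p2 = add_mset v (add_mset x p3)" "{v, x} \<in> E" "matched E p3"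
        using matched_removeE[OF less.prems(1)] by metis
      have q': "q = add_mset x (add_mset r (p1 + p3))"
        using less.prems(3) by (simp add: p add_mset_commute)
      obtain y q1 where q: "q = add_mset x (add_mset y q1)" "{x, y} \<in> E" "matched E q1"
        using matched_removeE[OF less.prems(2), of x] q' by auto
      have "add_mset r (p1 + p3) = add_mset y q1"
        using q' q by simp
      moreover have "size p3 < size p2" by (simp add: p)
      ultimately obtain w z where w: "odd (length w)" "hd w = y" "last w = z"
        "successively (\<lambda>u v. {u, v} \<in> E) w" "z = r \<or> z \<in># p1"
        "mset (butlast w) \<subseteq># p3" "matched E (p3 - mset (butlast w))" "matched E (mset (butlast w))"
        using less.hyps[OF _ p(3) q(3)] by blast
      have "w \<noteq> []" using w(1) by auto
      moreover have "matched E (add_mset v (add_mset x (mset (butlast w))))"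
        using w(8) p(2) by (rule matched.add)
      ultimately show ?thesis
        using w(1-7) p(2) q(2) by (intro exI[of _ "v # x # w"] exI[of _ z])
          (auto simp: p successively_Cons)
    qed
  qed
  then show thesis using that by blast
qed

section \<open>Critical and factor-critical weights\<close>

text \<open>If \<open>C\<close> is nonempty, this forces the matching number of \<open>a\<close> to be \<open>s\<close>.\<close>

definition critical :: "'v set set \<Rightarrow> 'v set \<Rightarrow> nat \<Rightarrow> 'v multiset \<Rightarrow> bool" where
  "critical E C s a \<longleftrightarrow>
     (\<forall>p. matched E p \<longrightarrow> p \<subseteq># a \<longrightarrow> size p \<le> 2 * s) \<and>
     (\<forall>i\<in>C. \<exists>p. matched E p \<and> p \<subseteq># add_mset i a \<and> size p = 2 * s + 2)"

text \<open>In the next two definitions \<open>s\<close> is meant to be the matching number of \<open>a\<close>.\<close>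

definition missable :: "'v set set \<Rightarrow> nat \<Rightarrow> 'v multiset \<Rightarrow> 'v \<Rightarrow> bool" where
  "missable E s a x \<longleftrightarrow> (\<exists>p. matched E p \<and> size p = 2 * s \<and> add_mset x p \<subseteq># a)"

definition inseparable :: "'v set set \<Rightarrow> nat \<Rightarrow> 'v multiset \<Rightarrow> 'v \<Rightarrow> 'v \<Rightarrow> bool" where
  "inseparable E s a x y \<longleftrightarrow>
     (\<nexists>p. matched E p \<and> size p = 2 * s \<and> add_mset x (add_mset y p) \<subseteq># a)"

text \<open>For loopless \<open>E\<close> this says that the graph in which each vertex is replaced
  by as many pairwise non-adjacent copies as its multiplicity is factor-critical in the usual
  sense.\<close>

definition factor_critical :: "'v set set \<Rightarrow> 'v multiset \<Rightarrow> bool" where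
  "factor_critical E a \<longleftrightarrow> a \<noteq> {#} \<and> (\<forall>x\<in>#a. matched E (a - {#x#}))"

lemma factor_critical_odd: "factor_critical E a \<Longrightarrow> odd (size a)"
proof -
  assume "factor_critical E a"
  then obtain x where x: "x \<in># a" "matched E (a - {#x#})"
    unfolding factor_critical_def by (metis multiset_nonemptyE)
  have "even (size (a - {#x#}))" using x(2) by (rule matched_even)
  with size_Suc_Diff1[OF x(1)] show ?thesis by (metis even_Suc)
qed

text \<open>A matching with s + 1 edges must use the added copy of \<open>i\<close>. Without its
  edge there, s edges remain inside \<open>a\<close>, and they spare a copy of the other end
  \<open>j\<close>.\<close>

lemma critical_missable_neighbour:
  assumes "critical E C s a" and "i \<in> C"
  obtains j where "{i, j} \<in> E" and "missable E s a j"
proof -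
  obtain p where p: "matched E p" "p \<subseteq># add_mset i a" "size p = 2 * s + 2"
    using assms by (auto simp: critical_def)
  have "\<not> p \<subseteq># a"
    using assms(1) p unfolding critical_def by fastforce
  then have "i \<in># p"
    using p(2) by (metis diff_single_trivial subset_eq_diff_conv add_mset_add_single)
  then obtain j q where q: "p = add_mset i (add_mset j q)" "{i, j} \<in> E" "matched E q"
    using matched_removeE[OF p(1)] by metis
  have "missable E s a j"
    unfolding missable_def using p q by (intro exI[of _ q]) auto
  then show thesis using that q(2) by blast
qed

text \<open>All s-edge matchings use every copy of \<open>x\<close>, so deleting one copy costs one
  edge. For \<open>i\<close> in \<open>C\<close>, an s-edge matching sparing a neighbour
  \<open>j\<close> of \<open>i\<close> contains an edge at \<open>x\<close>; trading that edge for
  {i, j} gives the s edges required after the deletion.\<close>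

lemma critical_remove:
  assumes a: "critical E C s a" and "x \<in># a" and x: "\<not> missable E s a x"
  shows "s > 0" and "critical E C (s - 1) (a - {#x#})"
proof -
  show s: "s > 0"
  proof (rule ccontr)
    assume "\<not> s > 0"
    then have "missable E s a x"
      unfolding missable_def using \<open>x \<in># a\<close> by (intro exI[of _ "{#}"]) (auto intro: matched.empty)
    with x show False by blast
  qed
  have 1: "size p \<le> 2 * (s - 1)" if "matched E p" "p \<subseteq># a - {#x#}" for p
  proof -
    have "add_mset x p \<subseteq># a"
      using that(2) \<open>x \<in># a\<close> by (simp add: insert_subset_eq_iff)
    moreover have "size p \<le> 2 * s"
    proof -
      have "p \<subseteq># a"
        using that(2) diff_subset_eq_self by (rule subset_mset.order_trans)
      then show ?thesis using that(1) a by (simp add: critical_def)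
    qed
    ultimately have "size p \<noteq> 2 * s"
      using x that(1) by (auto simp: missable_def)
    with \<open>size p \<le> 2 * s\<close> matched_even[OF that(1)] show ?thesis by presburger
  qed
  have 2: "\<exists>p. matched E p \<and> p \<subseteq># add_mset i (a - {#x#}) \<and> size p = 2 * (s - 1) + 2"
    if i: "i \<in> C" for i
  proof -
    obtain j where j: "{i, j} \<in> E" "missable E s a j"
      using critical_missable_neighbour[OF a i] .
    then obtain p where p: "matched E p" "size p = 2 * s" "add_mset j p \<subseteq># a"
      by (auto simp: missable_def)
    have "x \<in># p"
    proof (rule ccontr)
      assume "x \<notin># p"
      then have "add_mset x p \<subseteq># a"
        using p(3) \<open>x \<in># a\<close> by (simp add: add_mset_subseteq_iff not_in_iff)
      then show False using x p unfolding missable_def by blast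
    qed
    then obtain z q where q: "p = add_mset x (add_mset z q)" "{x, z} \<in> E" "matched E q"
      using matched_removeE[OF p(1)] by metis
    have "add_mset j q \<subseteq># a - {#x#}"
    proof -
      have "add_mset j p = add_mset z (add_mset x (add_mset j q))"
        by (simp add: q add_mset_commute)
      then have "add_mset x (add_mset j q) \<subseteq># a"
        using p(3) by (simp only: add_mset_subseteq_iff)
      then show ?thesis by (simp only: insert_subset_eq_iff)
    qed
    then show ?thesis
      using matched.add[OF q(3) j(1)] p(2) s
      by (intro exI[of _ "add_mset i (add_mset j q)"]) (auto simp: q)
  qed
  show "critical E C (s - 1) (a - {#x#})"
    unfolding critical_def using 1 2 by blast
qed

lemma critical_reduce:
  assumes "critical E C s a"
  shows "\<exists>s' a'. s' \<le> s \<and> a' \<subseteq># a \<and> critical E C s' a' \<and> (\<forall>x\<in>#a'. missable E s' a' x)"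
  using assms
proof (induction "size a" arbitrary: s a rule: less_induct)
  case less
  show ?case
  proof (cases "\<forall>x\<in>#a. missable E s a x")
    case True
    then show ?thesis using less.prems by blast
  next
    case False
    then obtain x where x: "x \<in># a" "\<not> missable E s a x" by blast
    from critical_remove(2)[OF less.prems x]
    obtain s' a' where "s' \<le> s - 1" "a' \<subseteq># a - {#x#}" "critical E C s' a'"
      "\<forall>x\<in>#a'. missable E s' a' x"
      using less.hyps[of "a - {#x#}" "s - 1"] x(1) by (auto simp: size_Diff1_less)
    then show ?thesis
      by (meson diff_le_self diff_subset_eq_self le_trans subset_mset.order_trans)
  qed
qed

section \<open>Gallai's lemma for weights\<close>

lemma inseparable_edge:
  assumes "\<And>p. matched E p \<Longrightarrow> p \<subseteq># a \<Longrightarrow> size p \<le> 2 * s" and "{x, y} \<in> E"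
  shows "inseparable E s a x y"
  unfolding inseparable_def
proof (intro notI, elim exE conjE)
  fix p assume "matched E p" "size p = 2 * s" "add_mset x (add_mset y p) \<subseteq># a"
  with assms(1)[OF matched.add[OF _ assms(2)]] show False by fastforce
qed

text \<open>The key step of Gallai's lemma.\<close>

lemma inseparable_trans:
  assumes loopless: "\<And>x. {x} \<notin> E"
    and bound: "\<And>p. matched E p \<Longrightarrow> p \<subseteq># a \<Longrightarrow> size p \<le> 2 * s"
    and v: "missable E s a v"
    and uv: "inseparable E s a u v" and vw: "inseparable E s a v w"
  shows "inseparable E s a u w"
  unfolding inseparable_def
proof (intro notI, elim exE conjE)
  fix p assume p: "matched E p" "size p = 2 * s" "add_mset u (add_mset w p) \<subseteq># a"
  have p_le: "count p z + (if z = u then 1 else 0) + (if z = w then 1 else 0) \<le> count a z" for z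
    using mset_subset_eq_count[OF p(3), of z] by (auto split: if_splits)
  have uv': "\<not> add_mset u (add_mset v p) \<subseteq># a" and vw': "\<not> add_mset v (add_mset w p) \<subseteq># a"
    using uv vw p by (auto simp: inseparable_def)
  have "u \<noteq> v" using p(3) vw' by auto
  obtain q where q: "matched E q" "size q = 2 * s" "add_mset v q \<subseteq># a"
    using v by (auto simp: missable_def)
  have q_le: "count q z + (if z = v then 1 else 0) \<le> count a z" for z
    using mset_subset_eq_count[OF q(3), of z] by (auto split: if_splits)
  \<comment> \<open>\<open>p\<close> spares \<open>u\<close> and \<open>w\<close>; if it also spared
    a copy of \<open>v\<close>, it would separate \<open>u\<close> from \<open>v\<close>. Since
    \<open>q\<close> spares \<open>v\<close>, the exchange lemma applies at
    \<open>v\<close>.\<close>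
  have "count a v \<le> count p v"
  proof (rule ccontr)
    assume "\<not> count a v \<le> count p v"
    then have "add_mset u (add_mset v p) \<subseteq># a"
      using p(3) \<open>u \<noteq> v\<close> p_le[of u] by (simp add: add_mset_subseteq_iff)
    with uv' show False by blast
  qed
  then have qv: "count q v < count p v"
    using q_le[of v] by simp
  from matched_exchange[OF loopless p(1) q(1) qv] show False
  proof (elim disjE exE conjE)
    fix z assume z: "count p z < count q z" "matched E (add_mset z (p - {#v#}))"
    define p' where "p' = add_mset z (p - {#v#})"
    have "v \<in># p" using qv by (metis count_inI not_less0)
    then have p': "add_mset v p' = add_mset z p" "size p' = 2 * s"
      using p(2) size_Suc_Diff1[of v p] by (simp_all add: p'_def add_mset_commute[of v])
    have za: "count p z < count a z" using z(1) q_le[of z] by simp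
    \<comment> \<open>Trading \<open>v\<close> for \<open>z\<close> in \<open>p\<close> uses up one
      spare copy of \<open>z\<close>. That can be the only spare copy of at most one of
      \<open>u\<close> and \<open>w\<close>, so the new matching spares \<open>v\<close> together
      with the other one.\<close>
    have "add_mset z (add_mset u p) \<subseteq># a \<or> add_mset z (add_mset w p) \<subseteq># a"
    proof (cases "z = u \<and> u \<noteq> w")
      case True
      then have "add_mset z (add_mset w p) \<subseteq># a"
        using p(3) by blast
      then show ?thesis by blast
    next
      case False
      have "add_mset z (add_mset u p) \<subseteq># a"
        using False za p_le[of u] p(3) by (auto simp: add_mset_subseteq_iff split: if_splits)
      then show ?thesis by blast
    qed
    then have "add_mset u (add_mset v p') \<subseteq># a \<or> add_mset v (add_mset w p') \<subseteq># a"
      using p'(1) by (metis add_mset_commute)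
    then show False
      using uv vw p'(2) z(2) unfolding inseparable_def p'_def[symmetric] by blast
  next
    fix z assume z: "matched E (add_mset v (add_mset z q))"
      "add_mset v (add_mset z q) \<subseteq># p \<union># q"
    have "p \<union># q \<subseteq># a"
    proof (rule subset_mset.sup_least)
      show "p \<subseteq># a" "q \<subseteq># a" using p(3) q(3) by (simp_all add: add_mset_subseteq_iff)
    qed
    then have "add_mset v (add_mset z q) \<subseteq># a"
      using z(2) by (rule subset_mset.order_trans[rotated])
    then show False using bound[OF z(1)] q(2) by simp
  qed
qed

text \<open>A maximum matching spares at most one copy from \<open>K\<close>, because
  \<open>K\<close> is pairwise inseparable, each element also from itself. As no edge inside the
  support of \<open>a\<close> leaves \<open>K\<close>, a matching that spares \<open>j\<close>
  restricts to a perfect matching of the rest of the \<open>K\<close>-part. This makes the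
  \<open>K\<close>-part odd, so every maximum matching spares exactly one copy from it.\<close>

lemma inseparable_class:
  assumes missable: "\<And>x. x \<in># a \<Longrightarrow> missable E s a x"
    and insep: "\<And>x y. x \<in> K \<Longrightarrow> y \<in> K \<Longrightarrow> inseparable E s a x y"
    and closed: "\<And>x y. {x, y} \<in> E \<Longrightarrow> x \<in># a \<Longrightarrow> y \<in># a \<Longrightarrow> x \<in> K \<longleftrightarrow> y \<in> K"
    and K: "K \<noteq> {}" "K \<subseteq> set_mset a"
  shows "factor_critical E (filter_mset (\<lambda>x. x \<in> K) a)" (is "factor_critical E ?b")
    and "matched E p \<Longrightarrow> size p = 2 * s \<Longrightarrow> p \<subseteq># a \<Longrightarrow>
      size (filter_mset (\<lambda>x. x \<in> K) a) = size (filter_mset (\<lambda>x. x \<in> K) p) + 1"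
proof -
  have closed': "matched E (filter_mset (\<lambda>x. x \<in> K) p)" if "matched E p" "p \<subseteq># a" for p
    using that(1)
  proof (rule matched_filter)
    fix x y assume "{x, y} \<in> E" "x \<in># p" "y \<in># p"
    then show "x \<in> K \<longleftrightarrow> y \<in> K" using closed that(2) by (meson mset_subset_eqD)
  qed
  have unique: "filter_mset (\<lambda>x. x \<in> K) (a - add_mset j p) = {#}"
    if p: "matched E p" "size p = 2 * s" "add_mset j p \<subseteq># a" and j: "j \<in> K" for p j
  proof (rule ccontr)
    assume "filter_mset (\<lambda>x. x \<in> K) (a - add_mset j p) \<noteq> {#}"
    then obtain k where "k \<in># filter_mset (\<lambda>x. x \<in> K) (a - add_mset j p)"
      by (metis multiset_nonemptyE)
    then have k: "k \<in> K" "k \<in># a - add_mset j p"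
      by (simp_all del: filter_diff_mset)
    then have "add_mset k (add_mset j p) \<subseteq># a"
      using p(3) by (simp add: add_mset_subseteq_iff[of k] in_diff_count)
    then show False using insep[OF k(1) j] p by (auto simp: inseparable_def)
  qed
  have fc: "matched E (?b - {#j#})" if j: "j \<in># ?b" for j
  proof -
    have jK: "j \<in> K" using j by simp
    obtain p where p: "matched E p" "size p = 2 * s" "add_mset j p \<subseteq># a"
      using missable[of j] j by (auto simp: missable_def)
    have "a = (a - add_mset j p) + add_mset j p"
      using subset_mset.diff_add[OF p(3)] by (rule sym)
    then have "?b = filter_mset (\<lambda>x. x \<in> K) (a - add_mset j p) + filter_mset (\<lambda>x. x \<in> K) (add_mset j p)"
      by (metis filter_union_mset)
    then have "?b = add_mset j (filter_mset (\<lambda>x. x \<in> K) p)"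
      using unique[OF p jK] jK by (simp del: filter_diff_mset)
    moreover have "p \<subseteq># a" using p(3) by (simp add: add_mset_subseteq_iff)
    ultimately show ?thesis using closed'[OF p(1)] by simp
  qed
  obtain x where "x \<in># ?b" using K by auto
  then have "?b \<noteq> {#}" by auto
  with fc show fcb: "factor_critical E ?b" by (auto simp: factor_critical_def)
  assume p: "matched E p" "size p = 2 * s" "p \<subseteq># a"
  let ?q = "filter_mset (\<lambda>x. x \<in> K) p"
  have sub: "?q \<subseteq># ?b" by (rule multiset_filter_mono[OF p(3)])
  have "odd (size ?b)" "even (size ?q)"
    using factor_critical_odd[OF fcb] matched_even[OF closed'[OF p(1,3)]] by auto
  then have "?b - ?q \<noteq> {#}"
    using sub by (metis subset_mset.diff_add add.left_neutral)
  then obtain j where j: "j \<in># ?b - ?q" by (metis multiset_nonemptyE)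
  have "filter_mset (\<lambda>x. x \<in> K) (a - p) = ?b - ?q" by simp
  with j have "j \<in># filter_mset (\<lambda>x. x \<in> K) (a - p)" by metis
  then have jK: "j \<in> K" "j \<in># a - p" by (simp_all del: filter_diff_mset)
  have "add_mset j p \<subseteq># a"
    using jK(2) p(3) by (simp add: add_mset_subseteq_iff in_diff_count)
  then have "a = (a - add_mset j p) + add_mset j p"
    by (rule subset_mset.diff_add[symmetric])
  then have "?b = filter_mset (\<lambda>x. x \<in> K) (a - add_mset j p) + filter_mset (\<lambda>x. x \<in> K) (add_mset j p)"
    by (metis filter_union_mset)
  then have "?b = add_mset j ?q"
    using unique[OF p(1,2) \<open>add_mset j p \<subseteq># a\<close> jK(1)] jK(1) by (simp del: filter_diff_mset)
  then show "size ?b = size ?q + 1" by simp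
qed

section \<open>Ear decompositions and factor-critical weights\<close>

abbreviation is_walk :: "'v set set \<Rightarrow> 'v list \<Rightarrow> bool" where
  "is_walk E w \<equiv> successively (\<lambda>u v. {u, v} \<in> E) w"

lemma is_walk_split: "is_walk E (xs @ z # ys) \<longleftrightarrow> is_walk E (xs @ [z]) \<and> is_walk E (z # ys)"
  by (auto simp: successively_append_iff)

text \<open>Odd-beginning ear decompositions with the list of ears forgotten: \<open>S\<close> holds
  the vertices reached so far and \<open>n\<close> counts the even ears, starting at 0 because the
  first cycle is odd. This form allows ears to be appended one at a time;
  \<open>eared_iff_decomposition\<close> recovers the list.\<close>

inductive eared :: "'v ugraph \<Rightarrow> 'v set \<Rightarrow> nat \<Rightarrow> bool" for G where
  cycle: "odd_cycle G w \<Longrightarrow> eared G (set w) 0"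
| add: "eared G S n \<Longrightarrow> ear G w \<Longrightarrow> set w \<inter> S = {hd w, last w} \<Longrightarrow>
    eared G (S \<union> set w) (n + (if even (walk_length w) then 1 else 0))"

text \<open>Cut the walk at an inner vertex in \<open>S\<close>, or split off a closed walk at a repeated vertex; a
  walk that admits neither is an ear. The bound is additive because halving rounds down.\<close>

lemma eared_extend_walk:
  assumes "eared G S n" and "is_walk (edges G) w" and "w \<noteq> []" and "hd w \<in> S" and "last w \<in> S"
  shows "\<exists>n'. eared G (S \<union> set w) n' \<and>
    n' + card (set w - S) \<le> n + 2 * ((length w - 1) div 2)"
  using assms
proof (induction "length w" arbitrary: w S n rule: less_induct)
  case less
  have two_walks: "\<exists>n'. eared G (S \<union> set w) n' \<and> n' + card (set w - S) \<le> n + 2 * ((length w - 1) div 2)"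
    if w1: "is_walk (edges G) w1" "w1 \<noteq> []" "hd w1 \<in> S" "last w1 \<in> S"
      and w2: "is_walk (edges G) w2" "w2 \<noteq> []" "hd w2 \<in> S \<union> set w1" "last w2 \<in> S \<union> set w1"
      and len: "length w1 + length w2 = length w + 1" "length w1 > 1" "length w2 > 1"
      and sets: "set w1 \<union> set w2 = set w"
    for w1 w2
  proof -
    have lens: "length w1 < length w" "length w2 < length w" using len by linarith+
    obtain n1 where n1: "eared G (S \<union> set w1) n1"
      "n1 + card (set w1 - S) \<le> n + 2 * ((length w1 - 1) div 2)"
      using less.hyps[OF lens(1) less.prems(1) w1] by blast
    obtain n2 where n2: "eared G (S \<union> set w1 \<union> set w2) n2"
      "n2 + card (set w2 - (S \<union> set w1)) \<le> n1 + 2 * ((length w2 - 1) div 2)"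
      using less.hyps[OF lens(2) n1(1) w2] by blast
    have "set w - S = (set w1 - S) \<union> (set w2 - (S \<union> set w1))" using sets by blast
    then have "card (set w - S) \<le> card (set w1 - S) + card (set w2 - (S \<union> set w1))"
      by (metis card_Un_le)
    moreover have "2 * ((length w1 - 1) div 2) + 2 * ((length w2 - 1) div 2) \<le> 2 * ((length w - 1) div 2)"
    proof -
      have eq: "length w - 1 = (length w1 - 1) + (length w2 - 1)" using len by linarith
      have "2 * (k div 2) + 2 * (l div 2) \<le> 2 * ((k + l) div 2)" for k l :: nat by presburger
      then show ?thesis unfolding eq .
    qed
    ultimately have "n2 + card (set w - S) \<le> n + 2 * ((length w - 1) div 2)"
      using n1(2) n2(2) by linarith
    moreover have "S \<union> set w1 \<union> set w2 = S \<union> set w" using sets by blast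
    ultimately show ?thesis using n2(1) by auto
  qed
  show ?case
  proof (cases "set w \<subseteq> S")
    case True
    then have "S \<union> set w = S" and *: "set w - S = {}" by auto
    then show ?thesis using less.prems(1) by (intro exI[of _ n]) (simp add: *)
  next
    case False
    obtain x w' where w': "w = x # w'" using less.prems(3) by (cases w) auto
    with False less.prems have "w' \<noteq> []" by auto
    then obtain m y where w: "w = x # m @ [y]" using w' by (cases w' rule: rev_cases) auto
    have xy: "x \<in> S" "y \<in> S" using less.prems by (auto simp: w)
    have "m \<noteq> []" using False xy by (auto simp: w)
    consider z where "z \<in> set m" "z \<in> S" | "\<not> distinct m" | "set m \<inter> S = {}" "distinct m"
      by blast
    then show ?thesis
    proof cases
      case 1
      then obtain m1 m2 where m: "m = m1 @ z # m2" by (meson split_list)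
      have "is_walk (edges G) (x # m1 @ [z])" "is_walk (edges G) (z # m2 @ [y])"
        using less.prems(2) is_walk_split[of _ "x # m1" z "m2 @ [y]"] by (simp_all add: w m)
      then show ?thesis
        by (intro two_walks[of "x # m1 @ [z]" "z # m2 @ [y]"]) (use xy 1 in \<open>auto simp: w m\<close>)
    next
      case 2
      then obtain m1 z m2 m3 where m: "m = m1 @ [z] @ m2 @ [z] @ m3"
        using not_distinct_decomp by blast
      have "is_walk (edges G) (x # m1 @ [z])" "is_walk (edges G) (z # m2 @ [z])"
        "is_walk (edges G) (z # m3 @ [y])"
        using less.prems(2) is_walk_split[of _ "x # m1" z "m2 @ z # m3 @ [y]"]
          is_walk_split[of _ "z # m2" z "m3 @ [y]"] by (simp_all add: w m)
      then have "is_walk (edges G) (x # m1 @ z # m3 @ [y])" "is_walk (edges G) (z # m2 @ [z])"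
        using is_walk_split[of _ "x # m1" z "m3 @ [y]"] by simp_all
      \<comment> \<open>The shortcut through \<open>z\<close> is treated first, so that
        \<open>z\<close> is already reached when the closed walk at \<open>z\<close> is
        attached.\<close>
      then show ?thesis
        by (intro two_walks[of "x # m1 @ z # m3 @ [y]" "z # m2 @ [z]"])
          (use xy in \<open>auto simp: w m\<close>)
    next
      case 3
      have "ear G w"
        using less.prems(2) xy 3 \<open>m \<noteq> []\<close> by (auto simp: ear_def w butlast_append)
      moreover have "set w \<inter> S = {hd w, last w}" using 3 xy by (auto simp: w)
      ultimately have "eared G (S \<union> set w) (n + (if even (walk_length w) then 1 else 0))"
        using less.prems(1) by (intro eared.add)
      moreover have "set w - S = set m" using 3 xy by (auto simp: w)
      then have "card (set w - S) = length m" using 3 by (simp add: distinct_card)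
      \<comment> \<open>In fact an equality: an ear with an odd number of inner vertices is even,
        and the unit charged for it rounds that number up to the next even one.\<close>
      moreover have "(if even (length m + 1) then 1 else 0) + length m \<le> 2 * ((length m + 1) div 2)"
        by (auto elim!: evenE oddE)
      ultimately show ?thesis
        by (intro exI[of _ "n + (if even (walk_length w) then 1 else 0)"])
          (simp add: walk_length_def w)
    qed
  qed
qed

text \<open>The list has one entry more than the walk has edges, so \<open>even (length w)\<close>
  means an odd walk. At a repeated vertex it splits into two closed walks, exactly one of them odd;
  that one is decomposed first and the even one is attached to it. Without a repetition it is an odd
  cycle, a loop being excluded.\<close>

lemma eared_odd_closed_walk:
  assumes loopless: "\<And>x. {x} \<notin> edges G"
    and "is_walk (edges G) w" and "hd w = last w" and "even (length w)" and "w \<noteq> []"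
  shows "\<exists>n. eared G (set w) n \<and> n + card (set w) \<le> length w - 1"
  using assms(2-)
proof (induction "length w" arbitrary: w rule: less_induct)
  case less
  obtain x w' where w': "w = x # w'" using less.prems(4) by (cases w) auto
  with less.prems have "w' \<noteq> []" by auto
  then obtain m y where "w = x # m @ [y]" using w' by (cases w' rule: rev_cases) auto
  with less.prems(2) have w: "w = x # m @ [x]" by simp
  show ?case
  proof (cases "distinct (x # m)")
    case True
    have "m \<noteq> []" using less.prems(1) loopless[of x] by (auto simp: w)
    moreover have "even (length m)" using less.prems(3) by (simp add: w)
    ultimately have "length m \<ge> 2" by (cases m; cases "tl m") auto
    then have "odd_cycle G w"
      using less.prems True by (auto simp: odd_cycle_def ear_def closed_walk_def walk_length_def w butlast_append)
    then have "eared G (set w) 0" by (rule eared.cycle)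
    moreover have "card (set w) = length (x # m)"
      using distinct_card[OF True] by (simp add: w insert_absorb)
    ultimately show ?thesis by (intro exI[of _ 0]) (simp add: w)
  next
    case False
    then obtain xs z ys zs where xm: "x # m = xs @ [z] @ ys @ [z] @ zs"
      using not_distinct_decomp by blast
    then have w2: "w = xs @ z # ys @ z # zs @ [x]" by (metis append.assoc append_Cons append_Nil w)
    have hd: "hd (xs @ [z]) = x" using xm by (cases xs) auto
    define c where "c = z # ys @ [z]"
    \<comment> \<open>What remains after cutting out \<open>c\<close>, rotated so that it starts and
      ends at \<open>z\<close>.\<close>
    define d where "d = z # zs @ xs @ [z]"
    have len: "length c + length d = length w + 1" by (simp add: c_def d_def w2)
    have walks: "is_walk (edges G) (xs @ [z])" "is_walk (edges G) c" "is_walk (edges G) (z # zs @ [x])"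
      using less.prems(1) is_walk_split[of "edges G" xs z "ys @ z # zs @ [x]"]
        is_walk_split[of "edges G" "z # ys" z "zs @ [x]"]
      by (simp_all add: c_def w2)
    then have c: "is_walk (edges G) c" by blast
    have d: "is_walk (edges G) d"
    proof (cases xs)
      case Nil
      then show ?thesis using walks hd by (simp add: d_def)
    next
      case (Cons x' xs')
      then show ?thesis
        using walks hd is_walk_split[of "edges G" "z # zs" x "xs' @ [z]"] by (simp add: d_def)
    qed
    have sets: "set c \<union> set d = set w"
      using hd by (cases xs) (auto simp: c_def d_def w2)
    \<comment> \<open>Here \<open>c\<close> is the odd part; stated for arbitrary closed walks at
      \<open>z\<close>, since either of the two parts can be the odd one.\<close>
    have main: "\<exists>n. eared G (set w) n \<and> n + card (set w) \<le> length w - 1"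
      if c: "even (length c)" "is_walk (edges G) c" "is_walk (edges G) d" "hd c = z" "last c = z" "hd d = z" "last d = z"
        "length c > 1" "length d > 1" "length c + length d = length w + 1" "set c \<union> set d = set w" for c d
    proof -
      obtain n where n: "eared G (set c) n" "n + card (set c) \<le> length c - 1"
      proof -
        have "length c < length w" "hd c = last c" "c \<noteq> []" using c by auto
        then show thesis using less.hyps c(1,2) that by blast
      qed
      have "z \<in> set c" using c(4,8) by (cases c) auto
      obtain n' where n': "eared G (set c \<union> set d) n'"
        "n' + card (set d - set c) \<le> n + 2 * ((length d - 1) div 2)"
      proof -
        have "d \<noteq> []" "hd d \<in> set c" "last d \<in> set c" using c \<open>z \<in> set c\<close> by auto
        then show thesis
          using eared_extend_walk[OF n(1) c(3)] that by blast
      qed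
      have "card (set w) \<le> card (set c) + card (set d - set c)"
        by (metis Un_Diff_cancel card_Un_le c(11))
      moreover have "2 * ((length d - 1) div 2) \<le> length d - 1" by (rule times_div_less_eq_dividend)
      ultimately have "n' + card (set w) \<le> length w - 1"
        using n n' c by linarith
      then show ?thesis using n'(1) c(11) by auto
    qed
    show ?thesis
    proof (cases "even (length c)")
      case True
      show ?thesis
        by (rule main[OF True c d _ _ _ _ _ _ len sets]) (auto simp: c_def d_def)
    next
      case False
      then have "even (length d)" using len less.prems(3) by presburger
      then show ?thesis
        by (rule main[OF _ d c]) (use len sets in \<open>auto simp: c_def d_def\<close>)
    qed
  qed
qed

text \<open>Lovasz' construction. Take an edge {u, v} leaving the support of \<open>b\<close>, and
  compare the perfect matching of \<open>a - b\<close> with a matching that spares only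
  \<open>v\<close>: the alternating walk from \<open>v\<close> must return to \<open>b\<close>. Its
  copies are moved into \<open>b\<close>. What is left stays matched, and the size gained pays for
  the new vertices and even ears.\<close>

lemma factor_critical_eared_grow:
  assumes connected: "\<And>S. S \<noteq> {} \<Longrightarrow> S \<subset> set_mset a \<Longrightarrow> \<exists>u\<in>S. \<exists>v\<in>set_mset a - S. {u, v} \<in> edges G"
    and fc: "factor_critical (edges G) a"
    and "b \<subseteq># a" and "r \<in># b" and "matched (edges G) (a - b)"
    and "eared G (set_mset b) n" and "n + card (set_mset b) \<le> size b"
  shows "\<exists>n. eared G (set_mset a) n \<and> n + card (set_mset a) \<le> size a"
  using assms(3-)
proof (induction "size (a - b)" arbitrary: b n rule: less_induct)
  case less
  have sub: "set_mset b \<subseteq> set_mset a" using less.prems(1) by (rule set_mset_mono)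
  show ?case
  proof (cases "set_mset b = set_mset a")
    case True
    then show ?thesis
      using less.prems size_mset_mono[OF less.prems(1)] by auto
  next
    case False
    then obtain u v where uv: "u \<in># b" "v \<in># a" "v \<notin># b" "{u, v} \<in> edges G"
      using connected[of "set_mset b"] sub less.prems(2) by fastforce
    have q: "matched (edges G) (a - {#v#})"
      using fc uv(2) by (simp add: factor_critical_def)
    \<comment> \<open>Splitting \<open>b\<close> into \<open>r\<close> and \<open>b - {#r#}\<close>
      makes all of \<open>b\<close> the set where the alternating walk may end.\<close>
    have "add_mset r ((b - {#r#}) + (a - b)) = add_mset v (a - {#v#})"
      using less.prems(1,2) uv(2) mset_subset_eqD[OF less.prems(1,2)]
      by (simp add: subset_mset.add_diff_inverse flip: union_mset_add_mset_left)
    from matched_alternating_walk[OF less.prems(3) q this]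
    obtain w y where w: "odd (length w)" "hd w = v" "last w = y" "is_walk (edges G) w"
      "y = r \<or> y \<in># b - {#r#}" "mset (butlast w) \<subseteq># a - b"
      "matched (edges G) (a - b - mset (butlast w))" by metis
    have y: "y \<in># b" using w(5) less.prems(2) by (auto dest: in_diffD)
    have w0: "w \<noteq> []" using w(1) by auto
    then have w_eq: "w = butlast w @ [y]" using w(3) by (metis append_butlast_last_id)
    have set_w: "set w = insert y (set (butlast w))" by (subst w_eq) simp
    define b' where "b' = b + mset (butlast w)"
    have "v \<in> set (butlast w)"
      using w(2) w_eq y uv(3) by (metis append_Nil hd_append2 hd_in_set list.sel(1))
    then have pos: "mset (butlast w) \<noteq> {#}" by auto
    have b'a: "b' \<subseteq># a"
      using w(6) less.prems(1) unfolding b'_def by (simp add: subset_mset.le_diff_conv2 add.commute)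
    have "is_walk (edges G) (u # w)"
      using w(2,4) uv(4) w0 by (cases w) auto
    from eared_extend_walk[OF less.prems(4) this]
    obtain n' where n': "eared G (set_mset b \<union> set (u # w)) n'"
      "n' + card (set (u # w) - set_mset b) \<le> n + 2 * (length w div 2)"
      using uv(1) y w(3) w0 by auto
    have set_b': "set_mset b \<union> set (u # w) = set_mset b'"
      using y uv(1) by (auto simp: b'_def set_w)
    \<comment> \<open>With \<open>u\<close> in front the walk has \<open>length w\<close> edges, an
      odd number; rounding down leaves exactly the number of copies added to
      \<open>b\<close>.\<close>
    have len: "2 * (length w div 2) = size (mset (butlast w))"
      using w(1) by (auto elim!: oddE)
    have "set_mset b' = set_mset b \<union> (set (u # w) - set_mset b)" using set_b' by blast
    then have "card (set_mset b') \<le> card (set_mset b) + card (set (u # w) - set_mset b)"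
      by (metis card_Un_le)
    then have "n' + card (set_mset b') \<le> size b'"
      using n'(2) less.prems(5) len by (simp add: b'_def)
    moreover have "size (a - b') < size (a - b)"
    proof -
      have "0 < size (mset (butlast w))" using pos unfolding nonempty_has_size .
      then have "size b < size b'" unfolding b'_def size_union by linarith
      then show ?thesis
        using size_mset_mono[OF b'a] by (simp add: size_Diff_submset b'a less.prems(1))
    qed
    moreover have "r \<in># b'" using less.prems(2) by (simp add: b'_def)
    moreover have "matched (edges G) (a - b')" using w(7) by (simp add: b'_def)
    ultimately show ?thesis
      using less.hyps[of b' n'] b'a n'(1) set_b' by simp
  qed
qed

text \<open>For an edge {r, v}, comparing the matchings that spare only \<open>r\<close> and only
  \<open>v\<close> gives an alternating walk of even length from \<open>v\<close> to
  \<open>r\<close>. The edge closes it to an odd closed walk, from which the ear decomposition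
  starts.\<close>

lemma factor_critical_eared:
  assumes loopless: "\<And>x. {x} \<notin> edges G"
    and connected: "\<And>S. S \<noteq> {} \<Longrightarrow> S \<subset> set_mset a \<Longrightarrow> \<exists>u\<in>S. \<exists>v\<in>set_mset a - S. {u, v} \<in> edges G"
    and fc: "factor_critical (edges G) a"
    and "card (set_mset a) \<ge> 2"
  shows "\<exists>n. eared G (set_mset a) n \<and> n + card (set_mset a) \<le> size a"
proof -
  obtain r where r: "r \<in># a" using fc unfolding factor_critical_def by (metis multiset_nonemptyE)
  have "set_mset a \<noteq> {r}"
  proof
    assume "set_mset a = {r}"
    with assms(4) show False by simp
  qed
  then have "{r} \<subset> set_mset a" using r by auto
  then obtain v where v: "v \<in># a" "{r, v} \<in> edges G" using connected[of "{r}"] by auto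
  have m: "matched (edges G) (a - {#r#})" "matched (edges G) (a - {#v#})"
    using fc r v(1) by (simp_all add: factor_critical_def)
  \<comment> \<open>With \<open>{#}\<close> as the first part, \<open>r\<close> is the only place
    where the walk can end.\<close>
  have "add_mset r ({#} + (a - {#r#})) = add_mset v (a - {#v#})" using r v(1) by simp
  from matched_alternating_walk[OF m this]
  obtain w where w: "odd (length w)" "hd w = v" "last w = r" "is_walk (edges G) w"
    "mset (butlast w) \<subseteq># a - {#r#}" "matched (edges G) (a - {#r#} - mset (butlast w))"
    by (metis empty_iff set_mset_empty)
  have w0: "w \<noteq> []" using w(1) by auto
  then have w_eq: "w = butlast w @ [r]" using w(3) by (metis append_butlast_last_id)
  define b where "b = add_mset r (mset (butlast w))"
  have "is_walk (edges G) (r # w)" using w(2,4) v(2) w0 by (cases w) auto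
  then obtain n where n: "eared G (set (r # w)) n" "n + card (set (r # w)) \<le> length w"
    using eared_odd_closed_walk[OF loopless, of "r # w"] w(1,3) w0 by auto
  have "set (r # w) = set_mset b" using w_eq
    by (metis b_def insert_absorb2 list.simps(15) mset.simps(2) mset_append set_mset_add_mset_insert
        set_mset_mset union_code Un_insert_right list.set(1) set_append sup_bot.right_neutral)
  moreover have "length w = size b" using w_eq by (metis b_def length_append_singleton size_add_mset size_mset)
  moreover have "b \<subseteq># a" using w(5) r by (simp add: b_def insert_subset_eq_iff)
  moreover have "matched (edges G) (a - b)" using w(6) by (simp add: b_def)
  ultimately show ?thesis
    using factor_critical_eared_grow[OF connected fc, of b r n] n by (simp add: b_def)
qed

section \<open>From ear decompositions back to factor-critical weights\<close>

lemma is_walk_ConsD: "is_walk E (x # w) \<Longrightarrow> is_walk E w"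
  by (cases w) auto

lemma is_walk_snocD: "is_walk E (w @ [x]) \<Longrightarrow> is_walk E w"
  by (simp add: successively_append_iff)

lemma matched_walk: "is_walk E w \<Longrightarrow> even (length w) \<Longrightarrow> matched E (mset w)"
proof (induction "length w" arbitrary: w rule: less_induct)
  case less
  show ?case
  proof (cases w)
    case Nil
    then show ?thesis by (simp add: matched.empty)
  next
    case (Cons x w')
    then obtain y v where w: "w = x # y # v" using less.prems(2) by (cases w') auto
    then have "matched E (mset v)"
      using less.hyps[of v] less.prems by (auto simp: successively_Cons)
    then show ?thesis using less.prems(1) by (simp add: w matched.add)
  qed
qed

text \<open>If the spared copy lies in \<open>a\<close>, then \<open>m\<close> is matched along
  itself. If it lies in \<open>m\<close>, it cuts \<open>m\<close> into an even and an odd piece;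
  the odd piece takes the end of the walk next to it, and \<open>a\<close> without that end is
  matched. The entries of \<open>m\<close> may repeat or already occur in \<open>a\<close>.\<close>

lemma factor_critical_extend_walk:
  assumes fc: "factor_critical E a" and walk: "is_walk E (x # m @ [y])"
    and "x \<in># a" and "y \<in># a" and "even (length m)"
  shows "factor_critical E (a + mset m)"
  unfolding factor_critical_def
proof (intro conjI ballI)
  show "a + mset m \<noteq> {#}" using assms(3) by auto
  have walk': "is_walk E (x # m)" "is_walk E (m @ [y])"
  proof -
    have "is_walk E ((x # m) @ [y])" using walk by simp
    then show "is_walk E (x # m)" by (rule is_walk_snocD)
    show "is_walk E (m @ [y])" using walk by (rule is_walk_ConsD)
  qed
  from walk'(2) have walk_m: "is_walk E m" by (rule is_walk_snocD)
  have fc': "matched E (a - {#z#})" if "z \<in># a" for z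
    using fc that by (simp add: factor_critical_def)
  fix j assume "j \<in># a + mset m"
  then consider "j \<in># a" | "j \<in> set m" by auto
  then show "matched E (a + mset m - {#j#})"
  proof cases
    case 1
    have "matched E (a - {#j#} + mset m)"
      using fc'[OF 1] matched_walk[OF walk_m assms(5)] by (rule matched_union)
    then show ?thesis using 1 by simp
  next
    case 2
    then obtain m1 m2 where m: "m = m1 @ j # m2" by (meson split_list)
    have walks: "is_walk E (x # m1)" "is_walk E m1" "is_walk E m2" "is_walk E (m2 @ [y])"
    proof -
      have "is_walk E ((x # m1) @ [j])" "is_walk E (j # m2 @ [y])"
        using walk is_walk_split[of E "x # m1" j "m2 @ [y]"] by (simp_all add: m)
      then show *: "is_walk E (x # m1)" "is_walk E (m2 @ [y])"
        by (blast dest: is_walk_ConsD is_walk_snocD)+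
      show "is_walk E m1" "is_walk E m2"
        using * by (blast dest: is_walk_ConsD is_walk_snocD)+
    qed
    show ?thesis
    proof (cases "even (length m1)")
      case True
      then have "even (length (m2 @ [y]))" using assms(5) by (simp add: m)
      then have "matched E (a - {#y#} + (mset m1 + mset (m2 @ [y])))"
        using fc'[OF assms(4)] True walks by (intro matched_union matched_walk)
      moreover have "a - {#y#} + (mset m1 + mset (m2 @ [y])) = a + mset m - {#j#}"
        using assms(4) by (simp add: m)
      ultimately show ?thesis by simp
    next
      case False
      then have "even (length (x # m1))" "even (length m2)" using assms(5) by (simp_all add: m)
      then have "matched E (a - {#x#} + (mset (x # m1) + mset m2))"
        using fc'[OF assms(3)] walks by (intro matched_union matched_walk)
      moreover have "a - {#x#} + (mset (x # m1) + mset m2) = a + mset m - {#j#}"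
        using assms(3) by (simp add: m)
      ultimately show ?thesis by simp
    qed
  qed
qed

lemma ear_inner:
  assumes "ear G w"
  obtains x m y where "w = x # m @ [y]" "x \<notin> set m" "y \<notin> set m" "distinct m"
    "is_walk (edges G) (x # m @ [y])" "walk_length w = length m + 1"
proof -
  obtain x w' where w': "w = x # w'" "w' \<noteq> []"
    using assms by (cases w; cases "tl w") (auto simp: ear_def)
  then obtain m y where w: "w = x # m @ [y]" by (cases w' rule: rev_cases) auto
  show thesis
    by (rule that[OF w]) (use assms in \<open>auto simp: ear_def w butlast_append walk_length_def\<close>)
qed

text \<open>An odd ear has an even number of inner vertices and is added as it stands. An even ear
  is first lengthened by an edge {z, x} inside the weight, which makes its end \<open>x\<close> an
  inner vertex: one more copy of \<open>x\<close> for each even ear.\<close>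

lemma eared_factor_critical:
  assumes loopless: "\<And>x. {x} \<notin> edges G" and "eared G S n"
  shows "card S \<ge> 2 \<and> (\<exists>a. factor_critical (edges G) a \<and> set_mset a = S \<and> size a = card S + n)"
  using assms(2)
proof (induction rule: eared.induct)
  case (cycle w)
  then have "ear G w" "hd w = last w" by (auto simp: odd_cycle_def closed_walk_def)
  from this(1) obtain x m y where w: "w = x # m @ [y]" "x \<notin> set m" "distinct m"
    "is_walk (edges G) (x # m @ [y])" "walk_length w = length m + 1"
    by (rule ear_inner)
  have y: "y = x" using w(1) \<open>hd w = last w\<close> by simp
  have m: "even (length m)" "length m \<ge> 2" using cycle w(5) by (auto simp: odd_cycle_def)
  have "factor_critical (edges G) {#x#}" by (simp add: factor_critical_def matched.empty)
  then have "factor_critical (edges G) ({#x#} + mset m)"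
    using factor_critical_extend_walk[of "edges G" "{#x#}" x m y] w(4) m(1) y by simp
  moreover have "set_mset ({#x#} + mset m) = set w" using y by (simp add: w)
  moreover have "card (set w) = length m + 1"
    using w(2) y distinct_card[OF w(3)] by (simp add: w(1) insert_absorb)
  ultimately show ?case using m(2) by (intro conjI exI[of _ "{#x#} + mset m"]) auto
next
  case (add S n w)
  from add.hyps(2) obtain x m y where w: "w = x # m @ [y]" "x \<notin> set m" "y \<notin> set m" "distinct m"
    "is_walk (edges G) (x # m @ [y])" "walk_length w = length m + 1"
    by (rule ear_inner)
  from add.IH obtain a where a: "card S \<ge> 2" "factor_critical (edges G) a" "set_mset a = S"
    "size a = card S + n" by blast
  have S: "x \<in> S" "y \<in> S" "set m \<inter> S = {}" using add.hyps(3) w(1-3) by auto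
  have "finite S" using a(3) by auto
  have set_w: "S \<union> set w = S \<union> set m" using S by (auto simp: w(1))
  have card: "card (S \<union> set w) = card S + length m"
    using S(3) \<open>finite S\<close> distinct_card[OF w(4)] set_w by (simp add: card_Un_disjoint Int_commute)
  show ?case
  proof (cases "even (length m)")
    case True
    then have "factor_critical (edges G) (a + mset m)"
      using factor_critical_extend_walk[OF a(2) w(5)] S a(3) by simp
    then show ?thesis
      using True card a set_w w(6) by (intro conjI exI[of _ "a + mset m"]) auto
  next
    case False
    \<comment> \<open>A matching of \<open>a - {#k#}\<close> covers \<open>x\<close> and hence
      supplies the partner \<open>z\<close>. The bound \<open>card S \<ge> 2\<close> is carried
      through the induction to provide \<open>k\<close>.\<close>
    obtain k where k: "k \<in> S" "k \<noteq> x"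
      using a(1) by (metis S(1) card_le_Suc0_iff_eq \<open>finite S\<close> not_less_eq_eq numeral_2_eq_2)
    then have "matched (edges G) (a - {#k#})" "x \<in># a - {#k#}"
      using a(2,3) S(1) by (auto simp: factor_critical_def in_diff_count)
    then obtain z q where z: "a - {#k#} = add_mset x (add_mset z q)" "{x, z} \<in> edges G"
      by (rule matched_removeE)
    have "z \<in># a" using z(1) by (metis in_diffD union_single_eq_member add_mset_commute)
    have "is_walk (edges G) (z # (x # m) @ [y])"
      using w(5) z(2) by (simp add: insert_commute)
    then have "factor_critical (edges G) (a + mset (x # m))"
      using factor_critical_extend_walk[OF a(2), of z "x # m" y] False \<open>z \<in># a\<close> S a(3) by simp
    moreover have "set_mset (a + mset (x # m)) = S \<union> set w"
      using a(3) S set_w by auto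
    ultimately show ?thesis
      using False card a w(6) by (intro conjI exI[of _ "a + mset (x # m)"]) auto
  qed
qed

text \<open>The closed walk i, j, i is an ear, so any neighbour of the set reached can be attached;
  one odd cycle in a connected graph is therefore enough.\<close>

lemma eared_exists:
  assumes connected: "\<And>S. S \<noteq> {} \<Longrightarrow> S \<subset> V \<Longrightarrow> \<exists>u\<in>S. \<exists>v\<in>V - S. {u, v} \<in> edges G"
    and "finite V" and "eared G S n" and "S \<subseteq> V" and "S \<noteq> {}"
  shows "\<exists>n. eared G V n"
  using assms(3-)
proof (induction "card (V - S)" arbitrary: S n rule: less_induct)
  case less
  show ?case
  proof (cases "S = V")
    case True
    then show ?thesis using less.prems by blast
  next
    case False
    then obtain u v where uv: "u \<in> S" "v \<in> V - S" "{u, v} \<in> edges G"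
      using connected[of S] less.prems by blast
    have "ear G [u, v, u]"
      using uv by (auto simp: ear_def insert_commute)
    then have "eared G (S \<union> set [u, v, u]) (n + (if even (walk_length [u, v, u]) then 1 else 0))"
      using less.prems(1) uv by (intro eared.add) auto
    moreover have "card (V - (S \<union> set [u, v, u])) < card (V - S)"
      using uv assms(2) by (intro psubset_card_mono) auto
    ultimately show ?thesis
      using less.hyps less.prems uv by (metis (no_types, lifting) DiffE Un_empty Un_least empty_set insert_subset list.simps(15) subsetD empty_subsetI)
  qed
qed

lemma UN_nth: "(\<Union>j<length ws. f (ws ! j)) = (\<Union>w\<in>set ws. f w)"
  by (fastforce simp: in_set_conv_nth)

text \<open>Ears depend only on the edges of \<open>G\<close>, so replacing its vertices by
  \<open>S\<close> only prescribes what the walks must exhaust. Both directions treat the last ear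
  of the list.\<close>

lemma eared_iff_decomposition:
  "eared G S n \<longleftrightarrow> (\<exists>ws. generalized_ear_decomposition (G\<lparr>verts := S\<rparr>) ws \<and>
     odd_cycle G (hd ws) \<and> length (filter (\<lambda>w. even (walk_length w)) ws) = n)"
proof
  have ear_eq: "ear (G\<lparr>verts := S\<rparr>) = ear G" for S by (simp add: ear_def fun_eq_iff)
  assume "eared G S n"
  then show "\<exists>ws. generalized_ear_decomposition (G\<lparr>verts := S\<rparr>) ws \<and>
     odd_cycle G (hd ws) \<and> length (filter (\<lambda>w. even (walk_length w)) ws) = n"
  proof (induction rule: eared.induct)
    case (cycle w)
    then show ?case
      by (intro exI[of _ "[w]"]) (auto simp: generalized_ear_decomposition_def odd_cycle_def ear_eq)
  next
    case (add S n w)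
    then obtain ws where ws: "generalized_ear_decomposition (G\<lparr>verts := S\<rparr>) ws"
      "odd_cycle G (hd ws)" "length (filter (\<lambda>w. even (walk_length w)) ws) = n" by blast
    have "set ((ws @ [w]) ! k) \<inter> (\<Union>j<k. set ((ws @ [w]) ! j)) = {hd ((ws @ [w]) ! k), last ((ws @ [w]) ! k)}"
      if k: "0 < k" "k < length (ws @ [w])" for k
    proof (cases "k = length ws")
      case True
      have "(\<Union>j<k. set ((ws @ [w]) ! j)) = (\<Union>j<length ws. set (ws ! j))"
        using True by (auto simp: nth_append)
      also have "\<dots> = S" unfolding UN_nth using ws(1) by (simp add: generalized_ear_decomposition_def)
      finally show ?thesis using True add.hyps(3) by simp
    next
      case False
      then have "k < length ws" using k by simp
      moreover from this have "(\<Union>j<k. set ((ws @ [w]) ! j)) = (\<Union>j<k. set (ws ! j))"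
        by (auto simp: nth_append)
      ultimately show ?thesis
        using ws(1) k(1) by (simp add: generalized_ear_decomposition_def nth_append)
    qed
    then show ?case
      using ws add.hyps(2) by (intro exI[of _ "ws @ [w]"])
        (auto simp: generalized_ear_decomposition_def ear_eq)
  qed
next
  have ear_eq: "ear (G\<lparr>verts := S\<rparr>) = ear G" for S by (simp add: ear_def fun_eq_iff)
  assume "\<exists>ws. generalized_ear_decomposition (G\<lparr>verts := S\<rparr>) ws \<and>
     odd_cycle G (hd ws) \<and> length (filter (\<lambda>w. even (walk_length w)) ws) = n"
  then obtain ws where "generalized_ear_decomposition (G\<lparr>verts := S\<rparr>) ws"
     "odd_cycle G (hd ws)" "length (filter (\<lambda>w. even (walk_length w)) ws) = n" by blast
  then show "eared G S n"
  proof (induction ws arbitrary: S n rule: rev_induct)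
    case Nil
    then show ?case by (simp add: generalized_ear_decomposition_def)
  next
    case (snoc w ws)
    show ?case
    proof (cases "ws = []")
      case True
      then have "S = set w" "n = 0" "odd_cycle G w"
        using snoc.prems by (auto simp: generalized_ear_decomposition_def odd_cycle_def)
      then show ?thesis by (simp add: eared.cycle)
    next
      case False
      have hd: "hd (ws @ [w]) = hd ws" using False by simp
      have *: "set ((ws @ [w]) ! k) \<inter> (\<Union>j<k. set ((ws @ [w]) ! j)) = {hd ((ws @ [w]) ! k), last ((ws @ [w]) ! k)}"
        if "0 < k" "k < length (ws @ [w])" for k
        using snoc.prems(1) that by (simp only: generalized_ear_decomposition_def)
      define S' where "S' = (\<Union>w\<in>set ws. set w)"
      define n' where "n' = length (filter (\<lambda>w. even (walk_length w)) ws)"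
      have "set (ws ! k) \<inter> (\<Union>j<k. set (ws ! j)) = {hd (ws ! k), last (ws ! k)}"
        if k: "0 < k" "k < length ws" for k
      proof -
        have "(\<Union>j<k. set ((ws @ [w]) ! j)) = (\<Union>j<k. set (ws ! j))"
          using k by (auto simp: nth_append)
        then show ?thesis using *[of k] k by (simp add: nth_append)
      qed
      then have "generalized_ear_decomposition (G\<lparr>verts := S'\<rparr>) ws"
        using snoc.prems(1) False hd
        by (auto simp: generalized_ear_decomposition_def ear_eq S'_def)
      then have "eared G S' n'"
        using snoc.IH[of S' n'] snoc.prems(2) hd by (simp add: n'_def)
      moreover have "ear G w" using snoc.prems(1) by (simp add: generalized_ear_decomposition_def ear_eq)
      moreover have "set w \<inter> S' = {hd w, last w}"
      proof -
        have "(\<Union>j<length ws. set ((ws @ [w]) ! j)) = (\<Union>j<length ws. set (ws ! j))"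
          by (auto simp: nth_append)
        then show ?thesis using *[of "length ws"] False by (simp add: UN_nth S'_def)
      qed
      ultimately have "eared G (S' \<union> set w) (n' + (if even (walk_length w) then 1 else 0))"
        by (rule eared.add)
      moreover have "S = S' \<union> set w"
        using snoc.prems(1) by (auto simp: generalized_ear_decomposition_def S'_def)
      moreover have "n = n' + (if even (walk_length w) then 1 else 0)"
        using snoc.prems(3) by (auto simp: n'_def)
      ultimately show ?thesis by simp
    qed
  qed
qed

section \<open>Components\<close>

definition comp_rel :: "'v ugraph \<Rightarrow> ('v \<times> 'v) set" where
  "comp_rel G = {(u, v) \<in> verts G \<times> verts G. (u, v) \<in> {(a, b). {a, b} \<in> edges G}\<^sup>*}"

lemma components_eq: "components G = verts G // comp_rel G"
  by (simp add: components_def comp_rel_def)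

lemma equiv_comp_rel: "equiv (verts G) (comp_rel G)"
proof -
  have "sym ({(a, b). {a, b} \<in> edges G}\<^sup>*)"
    by (rule sym_rtrancl) (auto simp: sym_def insert_commute)
  then show ?thesis
    by (auto simp: equiv_def refl_on_def sym_def trans_def comp_rel_def intro: rtrancl_trans)
qed

lemma component_edge:
  assumes "C \<in> components G" and "{x, y} \<in> edges G" and "x \<in> verts G" and "y \<in> verts G"
  shows "x \<in> C \<longleftrightarrow> y \<in> C"
proof -
  have "(x, y) \<in> comp_rel G" using assms by (auto simp: comp_rel_def)
  then show ?thesis
    using assms(1) equiv_comp_rel[of G] unfolding components_eq
    by (meson equivE in_quotient_imp_closed symD)
qed

lemma component_nonempty: "C \<in> components G \<Longrightarrow> C \<noteq> {}"
  unfolding components_eq using equiv_comp_rel by (rule in_quotient_imp_non_empty)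

lemma component_subset: "C \<in> components G \<Longrightarrow> C \<subseteq> verts G"
  unfolding components_eq using equiv_comp_rel by (rule in_quotient_imp_subset)

lemma component_reachable:
  assumes "C \<in> components G" and "x \<in> C" and "y \<in> C"
  shows "(x, y) \<in> {(a, b). {a, b} \<in> edges G}\<^sup>*"
  using in_quotient_imp_in_rel[OF equiv_comp_rel, of C G x y] assms
  by (auto simp: components_eq comp_rel_def)

lemma ex1_component: "x \<in> verts G \<Longrightarrow> \<exists>!C. C \<in> components G \<and> x \<in> C"
proof -
  assume "x \<in> verts G"
  then have "x \<in> \<Union>(components G)"
    unfolding components_eq Union_quotient[OF equiv_comp_rel] .
  moreover have "C = D" if "C \<in> components G" "D \<in> components G" "x \<in> C" "x \<in> D" for C D
    using quotient_disj[OF equiv_comp_rel, of C G D] that by (auto simp: components_eq)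
  ultimately show ?thesis by blast
qed

lemma finite_components: "finite (verts G) \<Longrightarrow> finite (components G)"
  unfolding components_eq by (rule finite_quotient) (auto simp: comp_rel_def)

lemma sum_card_components:
  assumes "finite (verts G)"
  shows "(\<Sum>C\<in>components G. card C) = card (verts G)"
proof -
  have "disjnt C D" if "C \<in> components G" "D \<in> components G" "C \<noteq> D" for C D
    using quotient_disj[OF equiv_comp_rel, of C G D] that by (auto simp: components_eq disjnt_def)
  then have "card (\<Union>(components G)) = (\<Sum>C\<in>components G. card C)"
    using finite_subset[OF component_subset assms]
    by (intro card_Union_disjoint) (auto simp: pairwise_def)
  then show ?thesis
    by (simp add: components_eq Union_quotient[OF equiv_comp_rel])
qed

text \<open>A path from \<open>S\<close> to a vertex of \<open>C\<close> outside it has an edge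
  leaving \<open>S\<close>, and this edge stays in \<open>C\<close>. The ear constructions use
  connectivity in this cut form.\<close>

lemma component_connected:
  assumes "simple_graph G" and C: "C \<in> components G" and S: "S \<noteq> {}" "S \<subset> C"
  shows "\<exists>u\<in>S. \<exists>v\<in>C - S. {u, v} \<in> edges (induced_subgraph G C)"
proof -
  obtain x y where xy: "x \<in> S" "y \<in> C" "y \<notin> S" using S by blast
  have "(x, y) \<in> {(a, b). {a, b} \<in> edges G}\<^sup>*"
    using component_reachable[OF C] xy S by blast
  then have "y \<in> S \<or> (\<exists>u\<in>S. \<exists>v. v \<notin> S \<and> {u, v} \<in> edges G)"
    by (induction rule: rtrancl_induct) (use xy in auto)
  with xy obtain u v where uv: "u \<in> S" "v \<notin> S" "{u, v} \<in> edges G" by blast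
  then have "{u, v} \<subseteq> verts G" using assms(1) by (auto simp: simple_graph_def)
  then have "v \<in> C" using component_edge[OF C uv(3)] uv S by auto
  then show ?thesis using uv S by (auto simp: induced_subgraph_def)
qed

section \<open>The invariant $\mu^*$ and dominating sets\<close>

lemma simple_graph_loopless: "simple_graph G \<Longrightarrow> {x} \<notin> edges G"
  by (auto simp: simple_graph_def)

lemma simple_graph_edge: "simple_graph G \<Longrightarrow> {x, y} \<in> edges G \<Longrightarrow> x \<in> verts G \<and> y \<in> verts G"
  by (auto simp: simple_graph_def)

lemma verts_induced [simp]: "verts (induced_subgraph G U) = U"
  by (simp add: induced_subgraph_def)

lemma edges_induced [simp]: "edges (induced_subgraph G U) = {e \<in> edges G. e \<subseteq> U}"
  by (simp add: induced_subgraph_def)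

lemma induced_induced: "U \<subseteq> C \<Longrightarrow> induced_subgraph (induced_subgraph G C) U = induced_subgraph G U"
  by (auto simp: induced_subgraph_def)

lemma simple_graph_induced: "simple_graph G \<Longrightarrow> U \<subseteq> verts G \<Longrightarrow> simple_graph (induced_subgraph G U)"
  by (auto simp: simple_graph_def finite_subset)

lemma matched_restrict:
  assumes "matched E p" and "set_mset p \<subseteq> C"
  shows "matched {e \<in> E. e \<subseteq> C} p"
  using assms by (induction rule: matched.induct) (auto intro: matched.intros)

lemma factor_critical_restrict:
  assumes "factor_critical E a" and "set_mset a \<subseteq> C"
  shows "factor_critical {e \<in> E. e \<subseteq> C} a"
  using assms matched_restrict unfolding factor_critical_def
  by (metis in_diffD subset_iff)

lemma factor_critical_mono: "factor_critical E a \<Longrightarrow> E \<subseteq> E' \<Longrightarrow> factor_critical E' a"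
  using matched_mono unfolding factor_critical_def by metis

lemma eared_component_iff:
  "eared (induced_subgraph G C) C n \<longleftrightarrow> (\<exists>ws. generalized_ear_decomposition (induced_subgraph G C) ws \<and>
     odd_cycle (induced_subgraph G C) (hd ws) \<and> length (filter (\<lambda>w. even (walk_length w)) ws) = n)"
  using eared_iff_decomposition[of "induced_subgraph G C" C n] by (simp add: induced_subgraph_def)

text \<open>The weight on a component pays for its vertices and for the even ears of some
  decomposition. Summing gives phi* + m \<le> 2 s + c.\<close>

lemma mu_star_le:
  fixes G :: "'v ugraph"
  assumes G: "simple_graph G"
    and b: "\<And>C. C \<in> components G \<Longrightarrow> factor_critical (edges G) (b C) \<and> set_mset (b C) = C \<and> card C \<ge> 2"
    and size: "(\<Sum>C\<in>components G. size (b C)) = 2 * s + card (components G)"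
  shows "strongly_non_bipartite G" and "mu_star G \<le> real s"
proof -
  have "\<exists>n ws. n + card C \<le> size (b C) \<and> generalized_ear_decomposition (induced_subgraph G C) ws \<and>
     odd_cycle (induced_subgraph G C) (hd ws) \<and> length (filter (\<lambda>w. even (walk_length w)) ws) = n"
    if C: "C \<in> components G" for C
  proof -
    let ?H = "induced_subgraph G C"
    have "factor_critical (edges ?H) (b C)"
      using factor_critical_restrict[of "edges G" "b C" C] b[OF C] by simp
    moreover have "{x} \<notin> edges ?H" for x using simple_graph_loopless[OF G] by simp
    ultimately obtain n where "eared ?H C n" "n + card C \<le> size (b C)"
      using factor_critical_eared[of ?H "b C"] b[OF C] component_connected[OF G C] by auto
    then show ?thesis unfolding eared_component_iff by blast
  qed
  then obtain f D where fD: "\<And>C. C \<in> components G \<Longrightarrow> f C + card C \<le> size (b C)"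
    "\<And>C. C \<in> components G \<Longrightarrow> generalized_ear_decomposition (induced_subgraph G C) (D C)"
    "\<And>C. C \<in> components G \<Longrightarrow> odd_cycle (induced_subgraph G C) (hd (D C))"
    "\<And>C. C \<in> components G \<Longrightarrow> length (filter (\<lambda>w. even (walk_length w)) (D C)) = f C"
    by metis
  show "strongly_non_bipartite G"
    unfolding strongly_non_bipartite_def using fD(3) by blast
  have "odd_beginning_ear_decomposition G D"
    unfolding odd_beginning_ear_decomposition_def using fD by blast
  then have "phi_star G \<le> num_even_walks G D"
    unfolding phi_star_def by (intro Least_le) blast
  also have "\<dots> = (\<Sum>C\<in>components G. f C)"
    unfolding num_even_walks_def using fD(4) by (intro sum.cong) auto
  finally have "phi_star G + card (verts G) \<le> (\<Sum>C\<in>components G. f C + card C)"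
    using sum_card_components[of G] G by (simp add: sum.distrib simple_graph_def)
  also have "\<dots> \<le> (\<Sum>C\<in>components G. size (b C))"
    using fD(1) by (rule sum_mono)
  finally have "phi_star G + card (verts G) \<le> 2 * s + card (components G)"
    using size by simp
  then show "mu_star G \<le> real s" unfolding mu_star_def by simp
qed

text \<open>An optimal decomposition turns into weights of total size m + phi*. The weight on each
  component has odd size, so m + phi* - c is even and \<mu>* is a natural number.\<close>

lemma mu_star_factor_critical:
  assumes G: "simple_graph G" and snb: "strongly_non_bipartite G"
  obtains b s where "\<And>C. C \<in> components G \<Longrightarrow> factor_critical (edges G) (b C) \<and> set_mset (b C) = C"
    "(\<Sum>C\<in>components G. size (b C)) = 2 * s + card (components G)" "mu_star G = real s"
proof -
  have loopless: "{x} \<notin> edges (induced_subgraph G C)" for x C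
    using simple_graph_loopless[OF G] by simp
  have "\<exists>ws. generalized_ear_decomposition (induced_subgraph G C) ws \<and>
     odd_cycle (induced_subgraph G C) (hd ws)" if C: "C \<in> components G" for C
  proof -
    let ?H = "induced_subgraph G C"
    obtain w where w: "odd_cycle ?H w"
      using snb C unfolding strongly_non_bipartite_def by blast
    then have "eared ?H (set w) 0" by (rule eared.cycle)
    moreover have "set w \<noteq> {}" using w by (auto simp: odd_cycle_def ear_def)
    \<comment> \<open>Each vertex of an ear lies on one of its edges, and the edges of
      \<open>?H\<close> lie in \<open>C\<close>.\<close>
    moreover have "set w \<subseteq> C"
    proof -
      have "ear ?H w" using w by (simp add: odd_cycle_def)
      then obtain x m y where *: "w = x # m @ [y]" "is_walk (edges ?H) (x # m @ [y])"
        by (rule ear_inner)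
      have "v \<in> C" if v: "v \<in> set w" for v
      proof -
        obtain w1 w2 where "w = w1 @ v # w2" using v by (meson split_list)
        then have "is_walk (edges ?H) (w1 @ [v])" "is_walk (edges ?H) (v # w2)" "w1 \<noteq> [] \<or> w2 \<noteq> []"
          using * is_walk_split[of "edges ?H" w1 v w2] by (auto simp: Cons_eq_append_conv)
        then show "v \<in> C"
          by (cases w2; cases w1 rule: rev_cases) (auto simp: successively_append_iff)
      qed
      then show ?thesis by blast
    qed
    moreover have "finite C"
      using component_subset[OF C] G by (auto simp: simple_graph_def intro: finite_subset)
    ultimately have "\<exists>n. eared ?H C n"
      using eared_exists[where V = C and G = ?H and S = "set w" and n = 0] component_connected[OF G C]
      by blast
    then show ?thesis unfolding eared_component_iff by blast
  qed
  then obtain D where "odd_beginning_ear_decomposition G D"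
    unfolding odd_beginning_ear_decomposition_def by metis
  then have "\<exists>D. odd_beginning_ear_decomposition G D \<and> num_even_walks G D = phi_star G"
    unfolding phi_star_def
    by (intro LeastI[of "\<lambda>k. \<exists>D. odd_beginning_ear_decomposition G D \<and> num_even_walks G D = k"
          "num_even_walks G D"]) blast
  then obtain D where D: "odd_beginning_ear_decomposition G D" "num_even_walks G D = phi_star G"
    by blast
  define f where "f C = length (filter (\<lambda>w. even (walk_length w)) (D C))" for C
  have "\<exists>a. factor_critical (edges G) a \<and> set_mset a = C \<and> size a = card C + f C"
    if C: "C \<in> components G" for C
  proof -
    let ?H = "induced_subgraph G C"
    have "eared ?H C (f C)"
      unfolding eared_component_iff f_def using D(1) C
      unfolding odd_beginning_ear_decomposition_def by blast
    then show ?thesis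
      using eared_factor_critical[OF loopless] factor_critical_mono[of "edges ?H" _ "edges G"]
      by fastforce
  qed
  then obtain b where b: "\<And>C. C \<in> components G \<Longrightarrow> factor_critical (edges G) (b C)"
    "\<And>C. C \<in> components G \<Longrightarrow> set_mset (b C) = C"
    "\<And>C. C \<in> components G \<Longrightarrow> size (b C) = card C + f C" by metis
  have "(\<Sum>C\<in>components G. size (b C)) = card (verts G) + phi_star G"
    using b(3) sum_card_components[of G] G D(2)
    by (simp add: sum.distrib num_even_walks_def f_def simple_graph_def)
  moreover define s where "s = (\<Sum>C\<in>components G. size (b C) div 2)"
  have "size (b C) = 2 * (size (b C) div 2) + 1" if "C \<in> components G" for C
    using factor_critical_odd[OF b(1)[OF that]] by presburger
  then have "(\<Sum>C\<in>components G. size (b C)) = (\<Sum>C\<in>components G. 2 * (size (b C) div 2) + 1)"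
    by (rule sum.cong[OF refl])
  then have s: "(\<Sum>C\<in>components G. size (b C)) = 2 * s + card (components G)"
    by (simp add: s_def sum_Suc sum_distrib_left)
  ultimately have "mu_star G = real s" unfolding mu_star_def by simp
  with b s show thesis by (intro that[of b s]) auto
qed

lemma critical_imp_dominating_set:
  assumes G: "simple_graph G" and "verts G \<noteq> {}"
    and "critical (edges G) (verts G) s a" and "set_mset a \<subseteq> verts G"
  shows "\<exists>U. dominating_set G U \<and> strongly_non_bipartite (induced_subgraph G U) \<and>
    mu_star (induced_subgraph G U) \<le> real s"
proof -
  obtain s' a' where a': "s' \<le> s" "a' \<subseteq># a" "critical (edges G) (verts G) s' a'"
    "\<And>x. x \<in># a' \<Longrightarrow> missable (edges G) s' a' x"
    using critical_reduce[OF assms(3)] by blast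
  define U where "U = set_mset a'"
  define H where "H = induced_subgraph G U"
  have U: "U \<subseteq> verts G"
    using set_mset_mono[OF a'(2)] assms(4) by (auto simp: U_def)
  have H: "simple_graph H" unfolding H_def by (rule simple_graph_induced[OF G U])
  \<comment> \<open>Vertices of \<open>U\<close> have a neighbour in \<open>U\<close> too. This is
    stronger than domination and gives every component at least two vertices.\<close>
  have nbr: "\<exists>j\<in>U. {i, j} \<in> edges G" if i: "i \<in> verts G" for i
  proof -
    obtain j where "{i, j} \<in> edges G" "missable (edges G) s' a' j"
      using critical_missable_neighbour[OF a'(3) i] .
    then show ?thesis
      unfolding missable_def U_def by (meson mset_subset_eq_insertD)
  qed
  have dom: "dominating_set G U"
    unfolding dominating_set_def using U nbr by (metis insert_commute)
  have loopless: "{x} \<notin> edges G" for x using simple_graph_loopless[OF G] .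
  have bound: "size p \<le> 2 * s'" if "matched (edges G) p" "p \<subseteq># a'" for p
    using a'(3) that by (auto simp: critical_def)
  note insep_trans = inseparable_trans[OF loopless bound a'(4)]
  note insep_edge = inseparable_edge[OF bound]
  have closed: "x \<in> K \<longleftrightarrow> y \<in> K"
    if "K \<in> components H" "{x, y} \<in> edges G" "x \<in># a'" "y \<in># a'" for K x y
    using component_edge[OF that(1), of x y] that by (simp add: H_def U_def)
  have nbr_K: "\<exists>j\<in>K. {x, j} \<in> edges G" if "K \<in> components H" "x \<in> K" for K x
  proof -
    have "x \<in> U" using component_subset[OF that(1)] that(2) by (auto simp: H_def)
    then obtain j where "j \<in> U" "{x, j} \<in> edges G" using nbr[of x] U by blast
    then show ?thesis using closed[OF that(1), of x j] \<open>x \<in> U\<close> that(2) by (auto simp: U_def)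
  qed
  have insep: "inseparable (edges G) s' a' x y" if K: "K \<in> components H" "x \<in> K" "y \<in> K" for K x y
  proof -
    obtain j where j: "j \<in> K" "{x, j} \<in> edges G" using nbr_K[OF K(1,2)] by blast
    have KU: "K \<subseteq> U" using component_subset[OF K(1)] by (simp add: H_def)
    \<comment> \<open>This says that no maximum matching spares two copies of \<open>x\<close>; it
      follows by transitivity through a neighbour \<open>j\<close>.\<close>
    have base: "inseparable (edges G) s' a' x x"
      by (rule insep_trans[of j]) (use j KU in \<open>auto simp: U_def insert_commute intro: insep_edge\<close>)
    have "(x, y) \<in> {(a, b). {a, b} \<in> edges H}\<^sup>*" using component_reachable[OF K] .
    then show ?thesis
    proof (induction rule: rtrancl_induct)
      case base
      show ?case by fact
    next
      case (step y z)
      then have "{y, z} \<in> edges G" "y \<in># a'" by (auto simp: H_def U_def)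
      then show ?case using insep_trans[of y x z] step.IH insep_edge by blast
    qed
  qed
  define b where "b K = filter_mset (\<lambda>x. x \<in> K) a'" for K
  have KU: "K \<subseteq> set_mset a'" if "K \<in> components H" for K
    using component_subset[OF that] by (simp add: H_def U_def)
  have FC: "factor_critical (edges H) (b K) \<and> set_mset (b K) = K \<and> card K \<ge> 2" if K: "K \<in> components H" for K
  proof -
    have "factor_critical (edges G) (b K)"
      unfolding b_def
      by (rule inseparable_class(1)[OF a'(4) insep[OF K] closed[OF K] component_nonempty[OF K] KU[OF K]])
    then have 1: "factor_critical (edges H) (b K)"
      using factor_critical_restrict[of "edges G" "b K" U] by (simp add: H_def U_def b_def subset_iff)
    obtain x where x: "x \<in> K" using component_nonempty[OF K] by blast
    then obtain j where j: "j \<in> K" "{x, j} \<in> edges G" using nbr_K[OF K] by blast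
    have "j \<noteq> x" using j(2) loopless[of x] by auto
    then have "card {x, j} = 2" by simp
    moreover have "finite K" using KU[OF K] by (rule finite_subset) simp
    ultimately have "card K \<ge> 2" using x j(1) card_mono[of K "{x, j}"] by simp
    with 1 KU[OF K] show ?thesis by (auto simp: b_def)
  qed
  obtain i where "i \<in> verts G" using assms(2) by blast
  then obtain j where "missable (edges G) s' a' j"
    using critical_missable_neighbour[OF a'(3)] by metis
  then obtain p where p: "matched (edges G) p" "size p = 2 * s'" "p \<subseteq># a'"
    unfolding missable_def by (metis mset_subset_eq_insertD subset_mset.less_imp_le)
  have part: "\<exists>!K. K \<in> components H \<and> x \<in> K" if "x \<in># a'" for x
    using ex1_component[of x H] that by (simp add: H_def U_def)
  have fin: "finite (components H)" using finite_components[of H] by (simp add: H_def U_def)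
  \<comment> \<open>The maximum matching \<open>p\<close> spares exactly one copy in each
    component.\<close>
  have "(\<Sum>K\<in>components H. size (b K)) = (\<Sum>K\<in>components H. size (filter_mset (\<lambda>x. x \<in> K) p) + 1)"
  proof (rule sum.cong[OF refl])
    fix K assume K: "K \<in> components H"
    show "size (b K) = size (filter_mset (\<lambda>x. x \<in> K) p) + 1"
      unfolding b_def
      by (rule inseparable_class(2)[OF a'(4) insep[OF K] closed[OF K] component_nonempty[OF K] KU[OF K] p])
  qed
  also have "\<dots> = (\<Sum>K\<in>components H. size (filter_mset (\<lambda>x. x \<in> K) p)) + card (components H)"
    by (simp add: sum_Suc)
  also have "(\<Sum>K\<in>components H. size (filter_mset (\<lambda>x. x \<in> K) p)) = size p"
    using part mset_subset_eqD[OF p(3)] by (intro sum_size_filter_partition[OF fin]) blast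
  finally have "(\<Sum>K\<in>components H. size (b K)) = 2 * s' + card (components H)"
    using p(2) by simp
  from mu_star_le[OF H FC this] have "strongly_non_bipartite H" "mu_star H \<le> real s'" by auto
  then show ?thesis using dom a'(1) unfolding H_def by force
qed

text \<open>Each added pair can be matched with itself. Such padding lifts a weight from the
  matching number \<mu>* to any larger one.\<close>

lemma factor_critical_pad:
  assumes "factor_critical E a" and "x \<in># a" and "y \<in># a" and "{x, y} \<in> E"
  shows "factor_critical E (a + repeat_mset n {#x, y#})"
proof (induction n)
  case 0
  then show ?case using assms(1) by simp
next
  case (Suc n)
  define c where "c = a + repeat_mset n {#x, y#}"
  have "matched E (add_mset x (add_mset y c) - {#j#})" if "j \<in># add_mset x (add_mset y c)" for j
  proof -
    have "j \<in># c" using that assms(2,3) by (auto simp: c_def)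
    then have "matched E (add_mset x (add_mset y (c - {#j#})))"
      using Suc.IH assms(4) by (auto simp: factor_critical_def c_def intro: matched.add)
    then show ?thesis using \<open>j \<in># c\<close> by (simp add: add_mset_commute)
  qed
  then have "factor_critical E (add_mset x (add_mset y c))"
    unfolding factor_critical_def by (intro conjI ballI add_mset_not_empty)
  moreover have "add_mset x (add_mset y c) = a + repeat_mset (Suc n) {#x, y#}"
    by (simp add: c_def add_mset_commute)
  ultimately show ?case by simp
qed

text \<open>Put a factor-critical weight on each component of the graph on \<open>U\<close>, padding
  one of them. A matching cannot join two components and by parity spares a copy in each, which
  bounds it by s edges. A vertex \<open>i\<close> has a neighbour \<open>j\<close> in
  \<open>U\<close>, which a suitable maximum matching spares; the edge {i, j} then gives s +
  1.\<close>

lemma dominating_set_imp_critical: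
  assumes G: "simple_graph G" and "verts G \<noteq> {}"
    and dom: "dominating_set G U" and snb: "strongly_non_bipartite (induced_subgraph G U)"
    and mu: "mu_star (induced_subgraph G U) \<le> real s"
  shows "\<exists>a. critical (edges G) (verts G) s a \<and> set_mset a \<subseteq> verts G"
proof -
  define H where "H = induced_subgraph G U"
  have U: "U \<subseteq> verts G" using dom by (simp add: dominating_set_def)
  have H: "simple_graph H" unfolding H_def by (rule simple_graph_induced[OF G U])
  have fin: "finite (components H)" using H by (simp add: finite_components simple_graph_def)
  obtain b s0 where b: "\<And>K. K \<in> components H \<Longrightarrow> factor_critical (edges H) (b K)"
    "\<And>K. K \<in> components H \<Longrightarrow> set_mset (b K) = K"
    and s0: "(\<Sum>K\<in>components H. size (b K)) = 2 * s0 + card (components H)" "mu_star H = real s0"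
    using mu_star_factor_critical[OF H] snb unfolding H_def by metis
  have "s0 \<le> s" using mu s0(2) by (simp add: H_def)
  have nbr_K: "\<exists>y\<in>K. {x, y} \<in> edges G" if K: "K \<in> components H" "x \<in> K" for K x
  proof -
    obtain w where "odd_cycle (induced_subgraph H K) w"
      using snb K(1) unfolding strongly_non_bipartite_def H_def[symmetric] by blast
    then obtain u v w' where "{u, v} \<in> edges (induced_subgraph H K)"
      by (cases w; cases "tl w") (auto simp: odd_cycle_def ear_def)
    then have uv: "u \<in> K" "v \<in> K" "{u, v} \<in> edges G" by (auto simp: H_def)
    show ?thesis
    proof (cases "x = u")
      case True
      then show ?thesis using uv by blast
    next
      case False
      then have "{x} \<subset> K" using K(2) uv(1) by blast
      then show ?thesis using component_connected[OF H K(1), of "{x}"] by (auto simp: H_def)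
    qed
  qed
  obtain i0 where "i0 \<in> verts G" using assms(2) by blast
  then have "U \<noteq> {}" using dom by (auto simp: dominating_set_def)
  then obtain K0 where K0: "K0 \<in> components H" using ex1_component[of _ H] by (force simp: H_def)
  obtain x0 where x0: "x0 \<in> K0" using component_nonempty[OF K0] by blast
  obtain y0 where y0: "y0 \<in> K0" "{x0, y0} \<in> edges G" using nbr_K[OF K0 x0] by blast
  have "K0 \<subseteq> U" using component_subset[OF K0] by (simp add: H_def)
  then have xy_edge: "{x0, y0} \<in> edges H" using x0 y0 by (auto simp: H_def)
  define c where "c K = (if K = K0 then b K + repeat_mset (s - s0) {#x0, y0#} else b K)" for K
  have c: "factor_critical (edges H) (c K)" "set_mset (c K) = K" if K: "K \<in> components H" for K
    using factor_critical_pad[OF b(1)[OF K0] _ _ xy_edge, of "s - s0"] b[OF K] b[OF K0] x0 y0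
    by (auto simp: c_def split: if_splits)
  have "(\<Sum>K\<in>components H. size (c K)) =
      (\<Sum>K\<in>components H. size (b K) + (if K = K0 then 2 * (s - s0) else 0))"
    by (rule sum.cong[OF refl]) (simp add: c_def)
  also have "\<dots> = 2 * s + card (components H)"
    using s0(1) fin K0 \<open>s0 \<le> s\<close> by (simp add: sum.distrib)
  finally have size_c: "(\<Sum>K\<in>components H. size (c K)) = 2 * s + card (components H)" .
  define a where "a = (\<Sum>K\<in>components H. c K)"
  have set_a: "set_mset a = U"
  proof -
    have "set_mset a = (\<Union>K\<in>components H. K)"
      using c(2) fin by (simp add: a_def set_mset_sum)
    also have "\<dots> = U"
      using ex1_component[of _ H] component_subset[of _ H] by (fastforce simp: H_def)
    finally show ?thesis .
  qed
  have filter_a: "filter_mset (\<lambda>x. x \<in> K) a = c K" if K: "K \<in> components H" for K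
  proof -
    have eq: "filter_mset (\<lambda>x. x \<in> K) (c L) = (if L = K then c K else {#})" if L: "L \<in> components H" for L
    proof (cases "L = K")
      case True
      then show ?thesis using c(2)[OF K] by (simp add: filter_mset_eq_conv)
    next
      case False
      have "x \<notin> K" if "x \<in> L" for x
        using False K L that ex1_component[of x H] component_subset[OF L] by blast
      then show ?thesis using False c(2)[OF L] by simp
    qed
    have "filter_mset (\<lambda>x. x \<in> K) a = (\<Sum>L\<in>components H. filter_mset (\<lambda>x. x \<in> K) (c L))"
      unfolding a_def by (induction rule: finite_induct[OF fin]) auto
    also have "\<dots> = (\<Sum>L\<in>components H. if L = K then c K else {#})"
      by (rule sum.cong[OF refl]) (rule eq)
    also have "\<dots> = c K" using fin K by simp
    finally show ?thesis .
  qed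
  have size_pred: "(\<Sum>K\<in>components H. size (c K) - 1) = 2 * s"
  proof -
    have "size (c K) = (size (c K) - 1) + 1" if "K \<in> components H" for K
      using c(1)[OF that] by (simp add: factor_critical_def nonempty_has_size)
    then have "(\<Sum>K\<in>components H. size (c K)) = (\<Sum>K\<in>components H. (size (c K) - 1) + 1)"
      by (rule sum.cong[OF refl])
    then show ?thesis using size_c by (simp add: sum_Suc)
  qed
  have bound: "size p \<le> 2 * s" if p: "matched (edges G) p" "p \<subseteq># a" for p
  proof -
    have "size (filter_mset (\<lambda>x. x \<in> K) p) \<le> size (c K) - 1" if K: "K \<in> components H" for K
    proof -
      have "matched (edges G) (filter_mset (\<lambda>x. x \<in> K) p)"
      proof (rule matched_filter[OF p(1)])
        fix x y assume "{x, y} \<in> edges G" "x \<in># p" "y \<in># p"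
        moreover from this have "x \<in> U" "y \<in> U" using mset_subset_eqD[OF p(2)] set_a by auto
        ultimately show "x \<in> K \<longleftrightarrow> y \<in> K" using component_edge[OF K, of x y] by (simp add: H_def)
      qed
      then have "even (size (filter_mset (\<lambda>x. x \<in> K) p))" by (rule matched_even)
      moreover have "odd (size (c K))" using factor_critical_odd[OF c(1)[OF K]] .
      moreover have "size (filter_mset (\<lambda>x. x \<in> K) p) \<le> size (c K)"
        using size_mset_mono[OF multiset_filter_mono[OF p(2)]] filter_a[OF K] by metis
      ultimately show ?thesis by (metis Suc_pred' le_SucE odd_pos)
    qed
    then have "(\<Sum>K\<in>components H. size (filter_mset (\<lambda>x. x \<in> K) p)) \<le> 2 * s"
      unfolding size_pred[symmetric] by (rule sum_mono)
    moreover have "(\<Sum>K\<in>components H. size (filter_mset (\<lambda>x. x \<in> K) p)) = size p"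
    proof (rule sum_size_filter_partition[OF fin])
      fix x assume "x \<in># p"
      then have "x \<in> verts H" using mset_subset_eqD[OF p(2)] set_a by (auto simp: H_def)
      then show "\<exists>!K. K \<in> components H \<and> x \<in> K" by (rule ex1_component)
    qed
    ultimately show ?thesis by simp
  qed
  have reach: "\<exists>p. matched (edges G) p \<and> p \<subseteq># add_mset i a \<and> size p = 2 * s + 2"
    if i: "i \<in> verts G" for i
  proof -
    obtain j where j: "j \<in> U" "{i, j} \<in> edges G"
    proof (cases "i \<in> U")
      case True
      then obtain K where K: "K \<in> components H" "i \<in> K" using ex1_component[of i H] by (auto simp: H_def)
      then obtain y where "y \<in> K" "{i, y} \<in> edges G" using nbr_K by blast
      then show ?thesis using that[of y] component_subset[OF K(1)] by (auto simp: H_def)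
    next
      case False
      then show ?thesis using i that dom unfolding dominating_set_def by (metis insert_commute)
    qed
    obtain K where K: "K \<in> components H" "j \<in> K" using ex1_component[of j H] j(1) by (auto simp: H_def)
    have "\<exists>x. x \<in> L" if "L \<in> components H" for L using component_nonempty[OF that] by blast
    then obtain r0 where r0: "\<And>L. L \<in> components H \<Longrightarrow> r0 L \<in> L" by metis
    \<comment> \<open>The copy to be spared in each component: \<open>j\<close> in its own
      component, an arbitrary one elsewhere.\<close>
    define r where "r = r0(K := j)"
    have r: "r L \<in># c L" if "L \<in> components H" for L
      using r0[OF that] K c(2)[OF that] by (simp add: r_def)
    define p where "p = (\<Sum>L\<in>components H. c L - {#r L#})"
    have "matched (edges G) p"
      unfolding p_def
    proof (rule matched_sum)
      fix L assume L: "L \<in> components H"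
      have "matched (edges H) (c L - {#r L#})" using c(1)[OF L] r[OF L] by (simp add: factor_critical_def)
      then show "matched (edges G) (c L - {#r L#})" by (rule matched_mono) (auto simp: H_def)
    qed
    then have "matched (edges G) (add_mset i (add_mset j p))" using j(2) by (rule matched.add)
    moreover have "a = p + (\<Sum>L\<in>components H. {#r L#})"
    proof -
      have "a = (\<Sum>L\<in>components H. (c L - {#r L#}) + {#r L#})"
        unfolding a_def by (rule sum.cong[OF refl]) (use r in simp)
      then show ?thesis by (simp only: sum.distrib p_def)
    qed
    moreover have "j \<in># (\<Sum>L\<in>components H. {#r L#})"
    proof -
      have "r K = j" by (simp add: r_def)
      then show ?thesis using K(1) fin by (auto simp: set_mset_sum)
    qed
    then have "{#j#} \<subseteq># (\<Sum>L\<in>components H. {#r L#})" by simp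
    then have "p + {#j#} \<subseteq># p + (\<Sum>L\<in>components H. {#r L#})"
      by (rule subset_mset.add_left_mono)
    moreover have "size p = 2 * s"
    proof -
      have "size p = (\<Sum>L\<in>components H. size (c L - {#r L#}))" unfolding p_def by (rule size_multiset_sum)
      also have "\<dots> = (\<Sum>L\<in>components H. size (c L) - 1)"
        by (rule sum.cong[OF refl]) (use r in \<open>simp add: size_Diff_singleton\<close>)
      finally show ?thesis using size_pred by simp
    qed
    ultimately show ?thesis by (intro exI[of _ "add_mset i (add_mset j p)"]) auto
  qed
  show ?thesis
    using bound reach set_a U by (intro exI[of _ a]) (auto simp: critical_def)
qed

section \<open>Monomial ideals\<close>

text \<open>Multisets of variables stand for exponent vectors, so that divisibility of monomials
  becomes \<subseteq># and the matching results apply directly.\<close>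

definition expo :: "'v multiset \<Rightarrow> ('v \<Rightarrow>\<^sub>0 nat)" where
  "expo a = (\<Sum>x\<in>#a. Poly_Mapping.single x 1)"

lemma expo_empty [simp]: "expo {#} = 0"
  by (simp add: expo_def)

lemma expo_add: "expo (a + b) = expo a + expo b"
  by (simp add: expo_def)

lemma lookup_expo [simp]: "Poly_Mapping.lookup (expo a) x = count a x"
  by (induction a) (auto simp: expo_def lookup_add lookup_single when_def)

lemma expo_eq_iff [simp]: "expo a = expo b \<longleftrightarrow> a = b"
  by (metis lookup_expo multiset_eqI)

lemma expo_cases:
  obtains a where "m = expo a"
proof
  show "m = expo (\<Sum>x\<in>Poly_Mapping.keys m. replicate_mset (Poly_Mapping.lookup m x) x)"
  proof (rule poly_mapping_eqI)
    fix k
    have "(\<Sum>x\<in>Poly_Mapping.keys m. if k = x then Poly_Mapping.lookup m x else 0) = Poly_Mapping.lookup m k"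
      by (simp add: in_keys_iff)
    then show "Poly_Mapping.lookup m k =
        Poly_Mapping.lookup (expo (\<Sum>x\<in>Poly_Mapping.keys m. replicate_mset (Poly_Mapping.lookup m x) x)) k"
      by (simp add: count_sum eq_commute)
  qed
qed

definition monomial :: "'v multiset \<Rightarrow> 'k \<Rightarrow> ('v, 'k::field) mpolynomial" where
  "monomial a c = Poly_Mapping.single (expo a) c"

lemma indet_eq_monomial: "indet x = monomial {#x#} 1"
  by (simp add: indet_def monomial_def expo_def)

lemma monomial_mult: "monomial a c * monomial b d = monomial (a + b) (c * d)"
  by (simp add: monomial_def mult_single expo_add)

lemma sum_monomials: "f = (\<Sum>m\<in>Poly_Mapping.keys f. Poly_Mapping.single m (Poly_Mapping.lookup f m))"
proof (rule poly_mapping_eqI)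
  fix k
  have "Poly_Mapping.lookup (\<Sum>m\<in>Poly_Mapping.keys f. Poly_Mapping.single m (Poly_Mapping.lookup f m)) k =
      (\<Sum>m\<in>Poly_Mapping.keys f. if m = k then Poly_Mapping.lookup f m else 0)"
    by (simp add: lookup_sum lookup_single when_def)
  then show "Poly_Mapping.lookup f k =
      Poly_Mapping.lookup (\<Sum>m\<in>Poly_Mapping.keys f. Poly_Mapping.single m (Poly_Mapping.lookup f m)) k"
    by (simp add: in_keys_iff)
qed

lemma lookup_monomial_mult:
  fixes f :: "('v, 'k::field) mpolynomial"
  shows "Poly_Mapping.lookup (f * monomial u 1) k =
    (\<Sum>m\<in>Poly_Mapping.keys f. if m + expo u = k then Poly_Mapping.lookup f m else 0)"
proof -
  have "f * monomial u 1 = (\<Sum>m\<in>Poly_Mapping.keys f. Poly_Mapping.single (m + expo u) (Poly_Mapping.lookup f m))"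
    by (subst sum_monomials[of f]) (simp add: sum_distrib_right monomial_def mult_single)
  then show ?thesis by (simp add: lookup_sum lookup_single when_def)
qed

lemma keys_monomial_mult:
  fixes f :: "('v, 'k::field) mpolynomial"
  shows "Poly_Mapping.keys (f * monomial u 1) = (\<lambda>m. m + expo u) ` Poly_Mapping.keys f"
proof (intro equalityI subsetI)
  fix k assume "k \<in> Poly_Mapping.keys (f * monomial u 1)"
  then have "(\<Sum>m\<in>Poly_Mapping.keys f. if m + expo u = k then Poly_Mapping.lookup f m else 0) \<noteq> 0"
    by (simp add: in_keys_iff lookup_monomial_mult)
  then obtain m where "m \<in> Poly_Mapping.keys f"
    "(if m + expo u = k then Poly_Mapping.lookup f m else 0) \<noteq> 0"
    by (rule sum.not_neutral_contains_not_neutral)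
  then have "m \<in> Poly_Mapping.keys f" "m + expo u = k" by (auto split: if_splits)
  then show "k \<in> (\<lambda>m. m + expo u) ` Poly_Mapping.keys f" by blast
next
  fix k assume "k \<in> (\<lambda>m. m + expo u) ` Poly_Mapping.keys f"
  then obtain m where "m \<in> Poly_Mapping.keys f" "k = m + expo u" by blast
  then show "k \<in> Poly_Mapping.keys (f * monomial u 1)"
    by (simp add: in_keys_iff lookup_monomial_mult)
qed

definition up_closed :: "'v multiset set \<Rightarrow> bool" where
  "up_closed A \<longleftrightarrow> (\<forall>a\<in>A. \<forall>b. a + b \<in> A)"

definition monomial_ideal :: "'v multiset set \<Rightarrow> ('v, 'k::field) mpolynomial set" where
  "monomial_ideal A = {f. Poly_Mapping.keys f \<subseteq> expo ` A}"

lemma monomial_in_monomial_ideal: "a \<in> A \<Longrightarrow> monomial a c \<in> monomial_ideal A"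
  by (auto simp: monomial_ideal_def monomial_def)

lemma monomial_in_monomial_ideal_iff: "monomial a 1 \<in> monomial_ideal A \<longleftrightarrow> a \<in> A"
  by (auto simp: monomial_ideal_def monomial_def)

lemma in_monomial_ideal_iff: "f \<in> monomial_ideal A \<longleftrightarrow> (\<forall>a. expo a \<in> Poly_Mapping.keys f \<longrightarrow> a \<in> A)"
proof
  assume "f \<in> monomial_ideal A"
  then show "\<forall>a. expo a \<in> Poly_Mapping.keys f \<longrightarrow> a \<in> A" by (auto simp: monomial_ideal_def)
next
  assume *: "\<forall>a. expo a \<in> Poly_Mapping.keys f \<longrightarrow> a \<in> A"
  have "m \<in> expo ` A" if "m \<in> Poly_Mapping.keys f" for m
    using * that expo_cases[of m] by blast
  then show "f \<in> monomial_ideal A" by (auto simp: monomial_ideal_def)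
qed

lemma mult_monomial_in_monomial_ideal_iff:
  "f * monomial u 1 \<in> monomial_ideal A \<longleftrightarrow> (\<forall>a. expo a \<in> Poly_Mapping.keys f \<longrightarrow> a + u \<in> A)"
proof -
  have "expo a + expo u \<in> expo ` A \<longleftrightarrow> a + u \<in> A" for a
    by (simp add: image_iff flip: expo_add)
  then have "(\<forall>m\<in>Poly_Mapping.keys f. m + expo u \<in> expo ` A) \<longleftrightarrow> (\<forall>a. expo a \<in> Poly_Mapping.keys f \<longrightarrow> a + u \<in> A)"
    by (metis expo_cases)
  then show ?thesis by (auto simp: monomial_ideal_def keys_monomial_mult)
qed

lemma additive_closed_contains:
  fixes f :: "('v, 'k::field) mpolynomial"
  assumes "0 \<in> J" and "\<And>g h. g \<in> J \<Longrightarrow> h \<in> J \<Longrightarrow> g + h \<in> J"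
    and "f \<in> monomial_ideal A" and "\<And>a c. a \<in> A \<Longrightarrow> monomial a c \<in> J"
  shows "f \<in> J"
proof -
  have "(\<Sum>m\<in>M. Poly_Mapping.single m (Poly_Mapping.lookup f m)) \<in> J" if "finite M" "M \<subseteq> expo ` A" for M
    using that assms(1,2,4) by (induction M rule: finite_induct) (auto simp: monomial_def)
  from this[of "Poly_Mapping.keys f"] show ?thesis
    using sum_monomials[of f] assms(3) by (simp add: monomial_ideal_def)
qed

lemma mpolynomial_ring_simps [simp]:
  "carrier ring_of_type_algebra = UNIV" "x \<otimes>\<^bsub>ring_of_type_algebra\<^esub> y = x * y"
  "x \<oplus>\<^bsub>ring_of_type_algebra\<^esub> y = x + y" "\<zero>\<^bsub>ring_of_type_algebra\<^esub> = 0"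
  "\<one>\<^bsub>ring_of_type_algebra\<^esub> = 1"
  by (simp_all add: ring_of_type_algebra_def)

lemma ideal_monomial_ideal:
  assumes "up_closed A"
  shows "ideal (monomial_ideal A :: ('v, 'k::field) mpolynomial set) mpolynomial_ring"
proof -
  interpret cring "mpolynomial_ring :: ('v, 'k) mpolynomial ring"
    by (rule cring_from_type_algebra)
  have 1: "f + g \<in> monomial_ideal A" if "f \<in> monomial_ideal A" "g \<in> monomial_ideal A" for f g :: "('v, 'k) mpolynomial"
    using that Poly_Mapping.keys_add[of f g] by (auto simp: monomial_ideal_def)
  have 2: "g * f \<in> monomial_ideal A" if "f \<in> monomial_ideal A" for f g :: "('v, 'k) mpolynomial"
  proof -
    have "m + n \<in> expo ` A" if mn: "m \<in> Poly_Mapping.keys g" "n \<in> Poly_Mapping.keys f" for m n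
    proof -
      obtain a where "m = expo a" by (rule expo_cases)
      moreover obtain b where "n = expo b" "b \<in> A" using mn(2) \<open>f \<in> _\<close> by (auto simp: monomial_ideal_def)
      moreover have "b + a \<in> A" using \<open>b \<in> A\<close> assms by (auto simp: up_closed_def)
      ultimately show ?thesis by (metis expo_add add.commute imageI)
    qed
    then show ?thesis using keys_mult[of g f] by (fastforce simp: monomial_ideal_def)
  qed
  show ?thesis
  proof (rule idealI)
    show "ring (mpolynomial_ring :: ('v, 'k) mpolynomial ring)" by (rule ring_axioms)
    show "subgroup (monomial_ideal A) (add_monoid (mpolynomial_ring :: ('v, 'k) mpolynomial ring))"
    proof (rule add.subgroupI)
      show "monomial_ideal A \<noteq> {}" by (auto simp: monomial_ideal_def intro: exI[of _ 0])
      fix f :: "('v, 'k) mpolynomial" assume f: "f \<in> monomial_ideal A"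
      have "\<ominus>\<^bsub>mpolynomial_ring\<^esub> f = - f"
        by (rule sum_zero_eq_neg[symmetric]) auto
      then show "\<ominus>\<^bsub>mpolynomial_ring\<^esub> f \<in> monomial_ideal A"
        using f 2[of f "-1"] by simp
    qed (use 1 in auto)
  qed (use 2 in \<open>auto simp: mult.commute\<close>)
qed

lemma genideal_monomials:
  "Idl\<^bsub>mpolynomial_ring\<^esub> ((\<lambda>a. monomial a 1) ` B) =
    (monomial_ideal {a. \<exists>b\<in>B. b \<subseteq># a} :: ('v, 'k::field) mpolynomial set)"
  (is "?L = monomial_ideal ?A")
proof
  interpret cring "mpolynomial_ring :: ('v, 'k) mpolynomial ring"
    by (rule cring_from_type_algebra)
  have "up_closed ?A"
    unfolding up_closed_def
    by (blast intro: subset_mset.order_trans[OF _ mset_subset_eq_add_left])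
  then have "ideal (monomial_ideal ?A :: ('v, 'k) mpolynomial set) mpolynomial_ring"
    by (rule ideal_monomial_ideal)
  then show "?L \<subseteq> monomial_ideal ?A"
    by (rule genideal_minimal) (auto intro!: monomial_in_monomial_ideal)
  have "ideal ?L mpolynomial_ring" by (rule genideal_ideal) simp
  then interpret L: ideal ?L "mpolynomial_ring" .
  show "monomial_ideal ?A \<subseteq> ?L"
  proof
    fix f :: "('v, 'k) mpolynomial" assume f: "f \<in> monomial_ideal ?A"
    show "f \<in> ?L"
    proof (rule additive_closed_contains[OF _ _ f])
      show "0 \<in> ?L" using L.zero_closed by simp
      show "g + h \<in> ?L" if "g \<in> ?L" "h \<in> ?L" for g h
        using L.a_closed[OF that] by simp
      fix a c assume "a \<in> ?A"
      then obtain b where b: "b \<in> B" "b \<subseteq># a" by blast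
      then have "monomial b 1 \<in> ?L" using genideal_self[of "(\<lambda>a. monomial a 1) ` B"] by auto
      from L.I_l_closed[OF this, of "monomial (a - b) c"]
      show "monomial a c \<in> ?L" using b(2) by (simp add: monomial_mult)
    qed
  qed
qed

lemma var_ideal_eq: "var_ideal F = monomial_ideal {a. \<exists>x\<in>F. x \<in># a}"
  using genideal_monomials[of "(\<lambda>x. {#x#}) ` F"]
  by (simp add: var_ideal_def image_image indet_eq_monomial[abs_def])

lemma edge_ideal_eq:
  "(edge_ideal G :: ('v, 'k::field) mpolynomial set) = monomial_ideal {a. \<exists>x y. {x, y} \<in> edges G \<and> {#x, y#} \<subseteq># a}"
proof -
  have "({indet i * indet j | i j. {i, j} \<in> edges G} :: ('v, 'k) mpolynomial set) =
      (\<lambda>a. monomial a 1) ` {{#i, j#} | i j. {i, j} \<in> edges G}"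
    by (auto simp: indet_eq_monomial monomial_mult add_mset_commute image_iff)
  moreover have "{a. \<exists>b\<in>{{#i, j#} | i j. {i, j} \<in> edges G}. b \<subseteq># a} =
      {a. \<exists>x y. {x, y} \<in> edges G \<and> {#x, y#} \<subseteq># a}" by blast
  ultimately show ?thesis by (simp only: edge_ideal_def genideal_monomials)
qed

lemma ideal_prod_monomial_ideal:
  "ideal_prod mpolynomial_ring (monomial_ideal A) (monomial_ideal B) =
    (monomial_ideal {a + b | a b. a \<in> A \<and> b \<in> B} :: ('v, 'k::field) mpolynomial set)"
  (is "?L = monomial_ideal ?C")
proof (intro equalityI subsetI)
  fix f :: "('v, 'k) mpolynomial" assume "f \<in> ?L"
  then show "f \<in> monomial_ideal ?C"
  proof (induction rule: ideal_prod.induct)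
    case (prod f g)
    have "m + n \<in> expo ` ?C" if mn: "m \<in> Poly_Mapping.keys f" "n \<in> Poly_Mapping.keys g" for m n
    proof -
      obtain a b where "m = expo a" "a \<in> A" "n = expo b" "b \<in> B"
        using mn prod unfolding monomial_ideal_def by blast
      then show ?thesis by (auto simp flip: expo_add)
    qed
    then show ?case using keys_mult[of f g] by (fastforce simp: monomial_ideal_def)
  next
    case (sum f g)
    then show ?case using Poly_Mapping.keys_add[of f g] by (auto simp: monomial_ideal_def)
  qed
next
  fix f :: "('v, 'k) mpolynomial" assume f: "f \<in> monomial_ideal ?C"
  show "f \<in> ?L"
  proof (rule additive_closed_contains[OF _ _ f])
    have "0 \<in> monomial_ideal A" "0 \<in> monomial_ideal B" by (auto simp: monomial_ideal_def)
    from ideal_prod.prod[OF this, of mpolynomial_ring] show "0 \<in> ?L" by simp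
    show "g + h \<in> ?L" if "g \<in> ?L" "h \<in> ?L" for g h
      using ideal_prod.sum[OF that] by simp
    fix c d assume "c \<in> ?C"
    then obtain a b where c: "c = a + b" "a \<in> A" "b \<in> B" by blast
    from ideal_prod.prod[OF monomial_in_monomial_ideal[OF c(2), of d]
        monomial_in_monomial_ideal[OF c(3), of 1], of mpolynomial_ring]
    show "monomial c d \<in> ?L" by (simp add: monomial_mult c(1))
  qed
qed

definition edge_power_exponents :: "'v set set \<Rightarrow> nat \<Rightarrow> 'v multiset set" where
  "edge_power_exponents E t = {a. \<exists>p. matched E p \<and> size p = 2 * t \<and> p \<subseteq># a}"

lemma up_closed_edge_power_exponents: "up_closed (edge_power_exponents E t)"
  unfolding up_closed_def edge_power_exponents_def
  by (blast intro: subset_mset.order_trans[OF _ mset_subset_eq_add_left])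

lemma ideal_power_edge_ideal:
  "ideal_power mpolynomial_ring (edge_ideal G) t =
    (monomial_ideal (edge_power_exponents (edges G) t) :: ('v, 'k::field) mpolynomial set)"
proof (induction t)
  case 0
  have "edge_power_exponents (edges G) 0 = UNIV"
    by (auto simp: edge_power_exponents_def intro: matched.empty)
  moreover have "Poly_Mapping.keys f \<subseteq> range expo" for f :: "('v, 'k) mpolynomial"
    by (metis expo_cases rangeI subsetI)
  ultimately show ?case
    by (simp add: ideal_power_def nat_pow_def ideals_set_def monomial_ideal_def)
next
  case (Suc t)
  have "{a + b | a b. a \<in> edge_power_exponents (edges G) t \<and>
      b \<in> {a. \<exists>x y. {x, y} \<in> edges G \<and> {#x, y#} \<subseteq># a}} = edge_power_exponents (edges G) (Suc t)"
    (is "?L = ?R")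
  proof (intro equalityI subsetI)
    fix c assume "c \<in> ?L"
    then obtain a b p x y where c: "c = a + b" "matched (edges G) p" "size p = 2 * t" "p \<subseteq># a"
      "{x, y} \<in> edges G" "{#x, y#} \<subseteq># b" by (auto simp: edge_power_exponents_def)
    have "p + {#x, y#} \<subseteq># a + b" using c(4,6) by (rule subset_mset.add_mono)
    moreover have "matched (edges G) (add_mset x (add_mset y p))" using c(2,5) by (rule matched.add)
    ultimately show "c \<in> ?R"
      using c(1,3) by (auto simp: edge_power_exponents_def intro!: exI[of _ "add_mset x (add_mset y p)"])
  next
    fix c assume "c \<in> ?R"
    then obtain p where p: "matched (edges G) p" "size p = 2 * Suc t" "p \<subseteq># c"
      by (auto simp: edge_power_exponents_def)
    from p(1) obtain q x y where q: "p = add_mset x (add_mset y q)" "{x, y} \<in> edges G" "matched (edges G) q"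
      by (cases rule: matched.cases) (use p(2) in auto)
    have "c = q + (c - q)" using p(3) q(1)
      by (metis add_mset_subseteq_iff subset_mset.add_diff_inverse)
    moreover have "{#x, y#} \<subseteq># c - q"
    proof -
      have "{#x, y#} + q \<subseteq># c" using p(3) q(1) by simp
      then show ?thesis
        by (metis subset_mset.le_diff_conv2 mset_subset_eq_add_right subset_mset.order_trans)
    qed
    moreover have "q \<in> edge_power_exponents (edges G) t"
      using q p(2) by (auto simp: edge_power_exponents_def)
    ultimately show "c \<in> ?L" using q(2) by blast
  qed
  moreover have "ideal_power mpolynomial_ring (edge_ideal G :: ('v, 'k) mpolynomial set) (Suc t) =
      ideal_prod mpolynomial_ring (ideal_power mpolynomial_ring (edge_ideal G) t) (edge_ideal G)"
    by (simp add: ideal_power_def nat_pow_def ideals_set_def)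
  ultimately show ?case
    using Suc by (simp only: edge_ideal_eq ideal_prod_monomial_ideal)
qed

section \<open>Associated primes of monomial ideals\<close>

lemma associated_primes_iff_annihilator:
  assumes "ideal J R" and "cring R"
  shows "P \<in> associated_primes R J \<longleftrightarrow>
    primeideal P R \<and> (\<exists>f\<in>carrier R. P = {r \<in> carrier R. r \<otimes>\<^bsub>R\<^esub> f \<in> J})"
proof -
  interpret cring R by fact
  interpret J: ideal J R by fact
  have "(J +>\<^bsub>R\<^esub> r) \<otimes>\<^bsub>R Quot J\<^esub> (J +>\<^bsub>R\<^esub> f) = \<zero>\<^bsub>R Quot J\<^esub> \<longleftrightarrow> r \<otimes>\<^bsub>R\<^esub> f \<in> J"
    if "r \<in> carrier R" "f \<in> carrier R" for r f
  proof -
    have "(J +>\<^bsub>R\<^esub> r) \<otimes>\<^bsub>R Quot J\<^esub> (J +>\<^bsub>R\<^esub> f) = J +>\<^bsub>R\<^esub> (r \<otimes>\<^bsub>R\<^esub> f)"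
      using that by (simp add: FactRing_def J.rcoset_mult_add)
    moreover have "\<zero>\<^bsub>R Quot J\<^esub> = J" by (simp add: FactRing_def)
    moreover have "J +>\<^bsub>R\<^esub> (r \<otimes>\<^bsub>R\<^esub> f) = J \<longleftrightarrow> r \<otimes>\<^bsub>R\<^esub> f \<in> J"
      using that J.rcos_const_imp_mem[of "r \<otimes>\<^bsub>R\<^esub> f"] a_rcos_zero[OF assms(1), of "r \<otimes>\<^bsub>R\<^esub> f"]
        m_closed[of r f] by blast
    ultimately show ?thesis by (simp only:)
  qed
  moreover have "carrier (R Quot J) = (\<lambda>f. J +>\<^bsub>R\<^esub> f) ` carrier R"
    by (auto simp: FactRing_def A_RCOSETS_def' a_r_coset_def)
  ultimately show ?thesis
    unfolding associated_primes_def by (simp cong: conj_cong)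
qed

text \<open>Some term of an annihilated \<open>f\<close> already serves as witness. Otherwise each
  term would be sent into the ideal by a monomial free of variables in \<open>F\<close>, and the
  product of these monomials would annihilate \<open>f\<close> without lying in the prime.
  Conversely, the monomial with exponent \<open>u\<close> is the required \<open>f\<close>.\<close>

lemma var_ideal_associated_iff:
  assumes up: "up_closed A"
  shows "(var_ideal F :: ('v, 'k::field) mpolynomial set) \<in>
      associated_primes mpolynomial_ring (monomial_ideal A) \<longleftrightarrow>
    primeideal (var_ideal F :: ('v, 'k) mpolynomial set) mpolynomial_ring \<and>
    (\<exists>u. (\<forall>i\<in>F. add_mset i u \<in> A) \<and> (\<forall>m. set_mset m \<inter> F = {} \<longrightarrow> m + u \<notin> A))"
    (is "?P \<in> _ \<longleftrightarrow> _ \<and> ?ex")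
proof -
  have "?P \<in> associated_primes mpolynomial_ring (monomial_ideal A) \<longleftrightarrow>
    primeideal ?P mpolynomial_ring \<and> (\<exists>f. ?P = {r. r * f \<in> monomial_ideal A})"
    using associated_primes_iff_annihilator[OF ideal_monomial_ideal[OF up, where 'k = 'k], of ?P]
      cring_from_type_algebra by simp
  moreover have "(\<exists>f. ?P = {r. r * f \<in> monomial_ideal A}) \<longleftrightarrow> ?ex"
  proof
    assume "\<exists>f. ?P = {r. r * f \<in> monomial_ideal A}"
    then obtain f where f: "?P = {r. r * f \<in> monomial_ideal A}" by blast
    define U where "U = {u. expo u \<in> Poly_Mapping.keys f}"
    have fin: "finite U"
    proof -
      have "inj_on expo U" by (simp add: inj_on_def)
      moreover have "expo ` U \<subseteq> Poly_Mapping.keys f" by (auto simp: U_def)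
      ultimately show ?thesis by (meson finite_imageD finite_keys finite_subset)
    qed
    have monomial_iff: "monomial a 1 \<in> ?P \<longleftrightarrow> (\<forall>u\<in>U. u + a \<in> A)" for a
      using mult_monomial_in_monomial_ideal_iff[of f a A] unfolding f U_def
      by (simp add: mult.commute)
    have F: "add_mset i u \<in> A" if "i \<in> F" "u \<in> U" for i u
    proof -
      have "monomial {#i#} 1 \<in> ?P"
        unfolding var_ideal_eq monomial_in_monomial_ideal_iff using that(1) by simp
      then have "u + {#i#} \<in> A" using monomial_iff that(2) by blast
      then show ?thesis by simp
    qed
    show ?ex
    proof (rule ccontr)
      assume "\<not> ?ex"
      then have "\<forall>u\<in>U. \<exists>m. set_mset m \<inter> F = {} \<and> m + u \<in> A" using F by blast
      then obtain m where m: "\<And>u. u \<in> U \<Longrightarrow> set_mset (m u) \<inter> F = {} \<and> m u + u \<in> A" by metis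
      \<comment> \<open>The product of the monomials \<open>m u\<close>: it multiplies every term of
        \<open>f\<close> into the ideal at once.\<close>
      define n where "n = (\<Sum>u\<in>U. m u)"
      have "u + n \<in> A" if "u \<in> U" for u
      proof -
        have "n = m u + (\<Sum>u\<in>U - {u}. m u)" unfolding n_def using fin that by (rule sum.remove)
        then have "u + n = (m u + u) + (\<Sum>u\<in>U - {u}. m u)" by (simp add: ac_simps)
        then show ?thesis using m[OF that] up unfolding up_closed_def by metis
      qed
      then have "monomial n 1 \<in> ?P" using monomial_iff by blast
      then have "\<exists>x\<in>F. x \<in># n" unfolding var_ideal_eq monomial_in_monomial_ideal_iff by simp
      then show False using m fin by (auto simp: n_def set_mset_sum)
    qed
  next
    assume ?ex
    then obtain u where u: "\<And>i. i \<in> F \<Longrightarrow> add_mset i u \<in> A"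
      "\<And>m. set_mset m \<inter> F = {} \<Longrightarrow> m + u \<notin> A" by blast
    have "a + u \<in> A \<longleftrightarrow> (\<exists>x\<in>F. x \<in># a)" for a
    proof
      assume "a + u \<in> A"
      then show "\<exists>x\<in>F. x \<in># a" using u(2) by blast
    next
      assume "\<exists>x\<in>F. x \<in># a"
      then obtain x where x: "x \<in> F" "x \<in># a" by blast
      have "a + u = add_mset x u + (a - {#x#})" using x(2) by simp
      then show "a + u \<in> A" using u(1)[OF x(1)] up by (simp only: up_closed_def)
    qed
    then have "r * monomial u 1 \<in> monomial_ideal A \<longleftrightarrow> r \<in> ?P" for r :: "('v, 'k) mpolynomial"
      unfolding mult_monomial_in_monomial_ideal_iff
      unfolding var_ideal_eq in_monomial_ideal_iff by simp
    then show "\<exists>f. ?P = {r. r * f \<in> monomial_ideal A}" by blast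
  qed
  ultimately show ?thesis by blast
qed

section \<open>Reduction to the core\<close>

lemma core_empty_iff_minimal_cover:
  assumes G: "simple_graph G" and F: "vertex_cover G F"
  shows "minimal_cover G F \<longleftrightarrow> core G F = {}"
proof
  assume min: "minimal_cover G F"
  show "core G F = {}"
  proof (rule ccontr)
    assume "core G F \<noteq> {}"
    then obtain v where v: "v \<in> F" "\<And>u. u \<in> verts G \<Longrightarrow> u \<notin> F \<Longrightarrow> {u, v} \<notin> edges G"
      by (auto simp: core_def)
    have "\<not> vertex_cover G (F - {v})"
      using min v(1) by (auto simp: minimal_cover_def)
    then obtain e where e: "e \<in> edges G" "e \<inter> (F - {v}) = {}"
      using F by (auto simp: vertex_cover_def)
    then obtain x y where "e = {x, y}" "x \<noteq> y" "x \<in> verts G" "y \<in> verts G"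
      using G by (auto simp: simple_graph_def card_2_iff)
    moreover have "e \<inter> F \<noteq> {}" using F e(1) by (auto simp: vertex_cover_def)
    moreover have "{v, u} \<notin> edges G" if "u \<in> verts G" "u \<notin> F" for u
      using v(2)[OF that] by (simp add: insert_commute)
    ultimately show False using e v by auto
  qed
next
  assume core: "core G F = {}"
  have "\<not> vertex_cover G F'" if F': "F' \<subset> F" for F'
  proof
    assume cover: "vertex_cover G F'"
    obtain v where v: "v \<in> F" "v \<notin> F'" using F' by blast
    then obtain u where "u \<notin> F" "{u, v} \<in> edges G" using core by (auto simp: core_def)
    then show False using cover v F' by (auto simp: vertex_cover_def)
  qed
  then show "minimal_cover G F" using F by (simp add: minimal_cover_def)
qed

lemma matched_submatching:
  assumes "matched E p" and "2 * n \<le> size p"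
  shows "\<exists>q. matched E q \<and> q \<subseteq># p \<and> size q = 2 * n"
  using assms
proof (induction rule: matched.induct)
  case empty
  then show ?case by (auto intro: matched.empty)
next
  case (add p x y)
  show ?case
  proof (cases "2 * n \<le> size p")
    case True
    then obtain q where "matched E q" "q \<subseteq># p" "size q = 2 * n" using add.IH by blast
    moreover have "p \<subseteq># add_mset x (add_mset y p)" by (simp add: subseteq_mset_def)
    ultimately show ?thesis by (meson subset_mset.order_trans)
  next
    case False
    have "even (size p)" using add.hyps(1) by (rule matched_even)
    then have "size p + 2 = 2 * n" using False add.prems by (auto elim!: evenE)
    then show ?thesis
      using matched.add[OF add.hyps(1,2)] by (intro exI[of _ "add_mset x (add_mset y p)"]) auto
  qed
qed

text \<open>By the definition of the core, an edge at a core vertex has both ends in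
  \<open>F\<close>. So every edge not inside the core uses a copy of a vertex of \<open>F\<close>
  outside the core; \<open>q\<close> arises by dropping these edges, each of which accounts for two
  covered copies.\<close>

lemma matched_core:
  assumes G: "simple_graph G" and F: "vertex_cover G F" and "matched (edges G) p"
  shows "\<exists>q. matched (edges (induced_subgraph G (core G F))) q \<and>
    q \<subseteq># filter_mset (\<lambda>x. x \<in> core G F) p \<and>
    size p \<le> size q + 2 * size (filter_mset (\<lambda>x. x \<in> F - core G F) p)"
  using assms(3)
proof (induction rule: matched.induct)
  case empty
  then show ?case by (auto intro: matched.empty)
next
  case (add p x y)
  let ?C = "core G F"
  obtain q where q: "matched (edges (induced_subgraph G ?C)) q"
    "q \<subseteq># filter_mset (\<lambda>x. x \<in> ?C) p"
    "size p \<le> size q + 2 * size (filter_mset (\<lambda>x. x \<in> F - ?C) p)" using add.IH by blast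
  have xy: "x \<in> verts G" "y \<in> verts G" using simple_graph_edge[OF G add.hyps(2)] by auto
  have "x \<in> F \<or> y \<in> F" using F add.hyps(2) by (auto simp: vertex_cover_def)
  moreover have "y \<in> F" if "x \<in> ?C"
    using that add.hyps(2) xy by (auto simp: core_def insert_commute)
  moreover have "x \<in> F" if "y \<in> ?C"
    using that add.hyps(2) xy by (auto simp: core_def)
  ultimately consider "x \<in> ?C" "y \<in> ?C" | "x \<in> F - ?C \<or> y \<in> F - ?C" by blast
  then show ?case
  proof cases
    case 1
    then have "matched (edges (induced_subgraph G ?C)) (add_mset x (add_mset y q))"
      using q(1) add.hyps(2) by (intro matched.add) auto
    then show ?thesis
      using q 1 by (intro exI[of _ "add_mset x (add_mset y q)"]) auto
  next
    case 2
    have "filter_mset (\<lambda>x. x \<in> ?C) p \<subseteq># filter_mset (\<lambda>x. x \<in> ?C) (add_mset x (add_mset y p))"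
      by (rule multiset_filter_mono) simp
    then have "q \<subseteq># filter_mset (\<lambda>x. x \<in> ?C) (add_mset x (add_mset y p))"
      using q(2) by (rule subset_mset.order_trans[rotated])
    moreover have "size (filter_mset (\<lambda>x. x \<in> F - ?C) p) + 1 \<le>
        size (filter_mset (\<lambda>x. x \<in> F - ?C) (add_mset x (add_mset y p)))"
      using 2 by auto
    ultimately show ?thesis
      using q(1,3) by (intro exI[of _ q]) (simp del: filter_mset_add_mset)
  qed
qed

text \<open>Once the variables outside \<open>F\<close> are inverted in R/I^t, the monomial with
  exponent \<open>u\<close> is a nonzero element killed by P_F, that is, a socle element at
  P_F.\<close>

definition socle_exponent :: "'v ugraph \<Rightarrow> 'v set \<Rightarrow> nat \<Rightarrow> 'v multiset \<Rightarrow> bool" where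
  "socle_exponent G F t u \<longleftrightarrow>
     (\<forall>i\<in>F. add_mset i u \<in> edge_power_exponents (edges G) t) \<and>
     (\<forall>m. set_mset m \<inter> F = {} \<longrightarrow> m + u \<notin> edge_power_exponents (edges G) t)"

text \<open>The t-th power of an edge avoiding \<open>F\<close> would be a monomial in the variables
  outside \<open>F\<close> that lies in I^t.\<close>

lemma socle_exponent_imp_cover:
  assumes G: "simple_graph G" "F \<subseteq> verts G" and u: "socle_exponent G F t u"
  shows "vertex_cover G F"
  unfolding vertex_cover_def
proof (intro conjI ballI notI)
  show "F \<subseteq> verts G" by fact
  fix e assume e: "e \<in> edges G" "e \<inter> F = {}"
  then obtain x y where xy: "e = {x, y}" using G(1) by (auto simp: simple_graph_def card_2_iff)
  let ?m = "repeat_mset t {#x, y#}"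
  have "matched (edges G) (repeat_mset n {#x, y#})" for n
  proof (induction n)
    case 0
    then show ?case by (simp add: matched.empty)
  next
    case (Suc n)
    have "repeat_mset (Suc n) {#x, y#} = add_mset x (add_mset y (repeat_mset n {#x, y#}))"
      by (simp add: add_mset_commute)
    then show ?case using matched.add[OF Suc, of x y] e(1) xy by metis
  qed
  then have "?m + u \<in> edge_power_exponents (edges G) t"
    unfolding edge_power_exponents_def by (intro CollectI exI[of _ ?m]) simp
  moreover have "set_mset ?m \<inter> F = {}" using e(2) xy by (auto split: if_splits)
  ultimately show False using u by (auto simp: socle_exponent_def)
qed

lemma edge_power_exponentsI:
  "matched E p \<Longrightarrow> 2 * t \<le> size p \<Longrightarrow> p \<subseteq># a \<Longrightarrow> a \<in> edge_power_exponents E t"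
  unfolding edge_power_exponents_def
  using matched_submatching subset_mset.order_trans by blast

text \<open>Let \<open>\<beta>\<close> be the degree of \<open>u\<close> in the vertices of
  \<open>F\<close> outside the core. Multiplying by neighbours outside \<open>F\<close> matches all
  these copies, so the core part of \<open>u\<close> has fewer than t - \<beta> matching edges.
  Conversely, of t edges in \<open>add_mset i u\<close> at most \<beta> are not inside the
  core.\<close>

lemma socle_exponent_imp_critical:
  assumes G: "simple_graph G" and F: "vertex_cover G F" and u: "socle_exponent G F t u"
  shows "\<exists>s a. s < t \<and> critical (edges (induced_subgraph G (core G F))) (core G F) s a \<and>
    set_mset a \<subseteq> core G F"
proof -
  let ?C = "core G F"
  let ?E = "edges (induced_subgraph G ?C)"
  define a where "a = filter_mset (\<lambda>x. x \<in> ?C) u"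
  define \<beta> where "\<beta> = size (filter_mset (\<lambda>x. x \<in> F - ?C) u)"
  have "\<exists>n. n \<in> verts G - F \<and> {n, x} \<in> edges G" if "x \<in> F - ?C" for x
    using that by (auto simp: core_def)
  then obtain n where n: "\<And>x. x \<in> F - ?C \<Longrightarrow> n x \<in> verts G - F"
    "\<And>x. x \<in> F - ?C \<Longrightarrow> {n x, x} \<in> edges G" by metis
  have pairing: "matched (edges G) (b + image_mset n b)" if "set_mset b \<subseteq> F - ?C" for b
    using that
  proof (induction b)
    case empty
    then show ?case by (simp add: matched.empty)
  next
    case (add x b)
    then have "matched (edges G) (add_mset (n x) (add_mset x (b + image_mset n b)))"
      using n(2)[of x] by (intro matched.add) auto
    then show ?case by (simp add: add_mset_commute)
  qed
  have bound: "size p + 2 * \<beta> < 2 * t" if p: "matched ?E p" "p \<subseteq># a" for p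
  proof (rule ccontr)
    assume large: "\<not> size p + 2 * \<beta> < 2 * t"
    define b where "b = filter_mset (\<lambda>x. x \<in> F - ?C) u"
    have "matched (edges G) p" using p(1) by (rule matched_mono) auto
    moreover have "matched (edges G) (b + image_mset n b)" by (rule pairing) (auto simp: b_def)
    ultimately have "matched (edges G) (p + (b + image_mset n b))" by (rule matched_union)
    moreover have "p + (b + image_mset n b) \<subseteq># image_mset n b + u"
    proof -
      have "p + b \<subseteq># a + b" using p(2) by simp
      also have "a + b \<subseteq># u"
        unfolding subseteq_mset_def by (simp add: a_def b_def)
      finally show ?thesis by (simp add: ac_simps)
    qed
    ultimately have "image_mset n b + u \<in> edge_power_exponents (edges G) t"
      using large by (intro edge_power_exponentsI) (auto simp: \<beta>_def b_def)
    moreover have "set_mset (image_mset n b) \<inter> F = {}" using n(1) by (auto simp: b_def)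
    ultimately show False using u by (auto simp: socle_exponent_def)
  qed
  have \<beta>: "\<beta> < t" using bound[of "{#}"] by (simp add: matched.empty)
  \<comment> \<open>t - 1 - \<beta> is the largest number of edges that \<open>bound\<close>
    permits; \<open>\<beta> < t\<close> keeps the subtraction exact.\<close>
  have "critical ?E ?C (t - 1 - \<beta>) a"
    unfolding critical_def
  proof (intro conjI allI impI ballI)
    fix p assume p: "matched ?E p" "p \<subseteq># a"
    have "even (size p)" using p(1) by (rule matched_even)
    then show "size p \<le> 2 * (t - 1 - \<beta>)" using bound[OF p] by (auto elim!: evenE)
  next
    fix i assume i: "i \<in> ?C"
    then have "i \<in> F" by (simp add: core_def)
    then obtain p where p: "matched (edges G) p" "size p = 2 * t" "p \<subseteq># add_mset i u"
      using u by (auto simp: socle_exponent_def edge_power_exponents_def)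
    obtain q where q: "matched ?E q" "q \<subseteq># filter_mset (\<lambda>x. x \<in> ?C) p"
      "size p \<le> size q + 2 * size (filter_mset (\<lambda>x. x \<in> F - ?C) p)"
      using matched_core[OF G F p(1)] by blast
    have "size (filter_mset (\<lambda>x. x \<in> F - ?C) p) \<le> size (filter_mset (\<lambda>x. x \<in> F - ?C) (add_mset i u))"
      by (intro size_mset_mono multiset_filter_mono p(3))
    also have "\<dots> = \<beta>" using i by (simp add: \<beta>_def)
    finally have "2 * (t - 1 - \<beta> + 1) \<le> size q" using q(3) p(2) \<beta> by simp
    from matched_submatching[OF q(1) this]
    obtain q' where q': "matched ?E q'" "q' \<subseteq># q" "size q' = 2 * (t - 1 - \<beta>) + 2" by auto
    have "q \<subseteq># add_mset i a"
    proof -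
      have "filter_mset (\<lambda>x. x \<in> ?C) p \<subseteq># filter_mset (\<lambda>x. x \<in> ?C) (add_mset i u)"
        by (intro multiset_filter_mono p(3))
      then show ?thesis using q(2) i by (auto simp: a_def intro: subset_mset.order_trans)
    qed
    then show "\<exists>p. matched ?E p \<and> p \<subseteq># add_mset i a \<and> size p = 2 * (t - 1 - \<beta>) + 2"
      using q' by (meson subset_mset.order_trans)
  qed
  moreover have "t - 1 - \<beta> < t" using \<beta> by simp
  moreover have "set_mset a \<subseteq> ?C" by (auto simp: a_def)
  ultimately show ?thesis by blast
qed

text \<open>The weight is enlarged by one copy of each vertex outside \<open>F\<close>. For
  \<open>i\<close> in \<open>F\<close> outside the core, one of these is the neighbour that adds an
  edge to a maximum matching of \<open>a\<close>. No copy from \<open>F\<close> outside the core is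
  present, so matchings of \<open>m + u\<close> lose nothing when restricted to the core.\<close>

lemma critical_imp_socle_exponent:
  assumes G: "simple_graph G" and F: "vertex_cover G F" and "core G F \<noteq> {}"
    and a: "critical (edges (induced_subgraph G (core G F))) (core G F) s a" "set_mset a \<subseteq> core G F"
  shows "\<exists>u. socle_exponent G F (s + 1) u"
proof -
  let ?C = "core G F"
  let ?E = "edges (induced_subgraph G ?C)"
  define u where "u = a + mset_set (verts G - F)"
  have fin: "finite (verts G - F)" using G by (simp add: simple_graph_def)
  obtain i0 where "i0 \<in> ?C" using assms(3) by blast
  then obtain j0 where "missable ?E s a j0" using critical_missable_neighbour[OF a(1)] by metis
  then obtain p0 where p0: "matched ?E p0" "size p0 = 2 * s" "p0 \<subseteq># a"
    by (auto simp: missable_def add_mset_subseteq_iff)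
  have "add_mset i u \<in> edge_power_exponents (edges G) (s + 1)" if i: "i \<in> F" for i
  proof (cases "i \<in> ?C")
    case True
    then obtain p where p: "matched ?E p" "p \<subseteq># add_mset i a" "size p = 2 * s + 2"
      using a(1) by (auto simp: critical_def)
    have "matched (edges G) p" using p(1) by (rule matched_mono) auto
    moreover have "add_mset i a \<subseteq># add_mset i u" by (simp add: u_def)
    ultimately show ?thesis
      using p by (intro edge_power_exponentsI[of _ p]) (auto intro: subset_mset.order_trans)
  next
    case False
    then obtain n where n: "n \<in> verts G - F" "{n, i} \<in> edges G" using i by (auto simp: core_def)
    have "matched (edges G) p0" using p0(1) by (rule matched_mono) auto
    then have "matched (edges G) (add_mset n (add_mset i p0))" using n(2) by (rule matched.add)
    moreover have "p0 + {#n#} \<subseteq># u"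
      unfolding u_def using n(1) fin by (intro subset_mset.add_mono p0(3)) simp
    then have "add_mset n (add_mset i p0) \<subseteq># add_mset i u"
      by (simp add: add_mset_commute)
    ultimately show ?thesis using p0(2) by (intro edge_power_exponentsI) auto
  qed
  moreover have "m + u \<notin> edge_power_exponents (edges G) (s + 1)" if m: "set_mset m \<inter> F = {}" for m
  proof
    assume "m + u \<in> edge_power_exponents (edges G) (s + 1)"
    then obtain p where p: "matched (edges G) p" "size p = 2 * (s + 1)" "p \<subseteq># m + u"
      by (auto simp: edge_power_exponents_def)
    obtain q where q: "matched ?E q" "q \<subseteq># filter_mset (\<lambda>x. x \<in> ?C) p"
      "size p \<le> size q + 2 * size (filter_mset (\<lambda>x. x \<in> F - ?C) p)"
      using matched_core[OF G F p(1)] by blast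
    have CF: "?C \<subseteq> F" by (auto simp: core_def)
    have *: "filter_mset (\<lambda>x. x \<in> F - ?C) (m + u) = {#}"
      by (rule filter_mset_eq_emptyI) (use m a(2) fin in \<open>auto simp: u_def\<close>)
    have "filter_mset (\<lambda>x. x \<in> F - ?C) p = {#}"
      using multiset_filter_mono[OF p(3), of "\<lambda>x. x \<in> F - ?C"]
      unfolding * by (simp only: subset_mset.le_zero_eq)
    from q(3)[unfolded this] have "2 * (s + 1) \<le> size q" using p(2) by simp
    moreover have "filter_mset (\<lambda>x. x \<in> ?C) (m + u) = a"
    proof -
      have "filter_mset (\<lambda>x. x \<in> ?C) m = {#}" "filter_mset (\<lambda>x. x \<in> ?C) (mset_set (verts G - F)) = {#}"
        by (rule filter_mset_eq_emptyI; use m CF fin in auto)+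
      moreover have "filter_mset (\<lambda>x. x \<in> ?C) a = a" using a(2) by (auto simp: filter_mset_eq_conv)
      ultimately show ?thesis by (simp add: u_def)
    qed
    then have "q \<subseteq># a"
      using q(2) multiset_filter_mono[OF p(3), of "\<lambda>x. x \<in> ?C"] by (simp add: subset_mset.order_trans)
    ultimately show False using a(1) q(1) by (fastforce simp: critical_def)
  qed
  ultimately show ?thesis unfolding socle_exponent_def by blast
qed

text \<open>Every edge of a matching now uses a copy from \<open>F\<close>. The witness contains
  exactly s such copies, all of them \<open>x\<close> from s copies of one edge, together with an
  outside neighbour for every vertex of \<open>F\<close>; if \<open>F\<close> is empty, there are no
  edges at all.\<close>

lemma core_empty_imp_socle_exponent:
  assumes G: "simple_graph G" and F: "vertex_cover G F" and core: "core G F = {}"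
  shows "\<exists>u. socle_exponent G F (s + 1) u"
proof -
  have fin: "finite (verts G - F)" using G by (simp add: simple_graph_def)
  have nbr: "\<exists>n. n \<in> verts G - F \<and> {n, x} \<in> edges G" if "x \<in> F" for x
    using that core by (auto simp: core_def)
  have few: "size p \<le> 2 * size (filter_mset (\<lambda>x. x \<in> F) p)" if "matched (edges G) p" for p
    using matched_core[OF G F that] by (simp add: core)
  show ?thesis
  proof (cases "F = {}")
    case True
    have "m \<notin> edge_power_exponents (edges G) (s + 1)" for m
      using few True by (fastforce simp: edge_power_exponents_def)
    then show ?thesis using True by (auto simp: socle_exponent_def)
  next
    case False
    then obtain x y where xy: "x \<in> F" "y \<in> verts G - F" "{y, x} \<in> edges G" using nbr by blast
    define w where "w = repeat_mset s {#y, x#}"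
    have w: "matched (edges G) (repeat_mset k {#y, x#})" for k
    proof (induction k)
      case (Suc k)
      have "repeat_mset (Suc k) {#y, x#} = add_mset y (add_mset x (repeat_mset k {#y, x#}))"
        by (simp add: add_mset_commute)
      then show ?case using matched.add[OF Suc xy(3)] by metis
    qed (simp add: matched.empty)
    define u where "u = w + mset_set (verts G - F)"
    have "add_mset i u \<in> edge_power_exponents (edges G) (s + 1)" if i: "i \<in> F" for i
    proof -
      obtain n where n: "n \<in> verts G - F" "{n, i} \<in> edges G" using nbr[OF i] by blast
      have "matched (edges G) (add_mset n (add_mset i w))"
        unfolding w_def using w n(2) by (rule matched.add)
      moreover have "w + {#n#} \<subseteq># u"
        unfolding u_def using n(1) fin by (intro subset_mset.add_mono) simp_all
      then have "add_mset n (add_mset i w) \<subseteq># add_mset i u"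
        by (simp add: add_mset_commute)
      ultimately show ?thesis by (intro edge_power_exponentsI) (auto simp: w_def)
    qed
    moreover have "m + u \<notin> edge_power_exponents (edges G) (s + 1)" if m: "set_mset m \<inter> F = {}" for m
    proof
      assume "m + u \<in> edge_power_exponents (edges G) (s + 1)"
      then obtain p where p: "matched (edges G) p" "size p = 2 * (s + 1)" "p \<subseteq># m + u"
        by (auto simp: edge_power_exponents_def)
      have "filter_mset (\<lambda>x. x \<in> F) m = {#}" "filter_mset (\<lambda>x. x \<in> F) (mset_set (verts G - F)) = {#}"
        by (rule filter_mset_eq_emptyI; use m fin in auto)+
      moreover have "filter_mset (\<lambda>x. x \<in> F) w = replicate_mset s x"
        unfolding w_def using xy(1,2) by (induction s) auto
      ultimately have "size (filter_mset (\<lambda>x. x \<in> F) (m + u)) = s" by (simp add: u_def)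
      then have "size (filter_mset (\<lambda>x. x \<in> F) p) \<le> s"
        using size_mset_mono[OF multiset_filter_mono[OF p(3), of "\<lambda>x. x \<in> F"]] by simp
      then show False using few[OF p(1)] p(2) by simp
    qed
    ultimately show ?thesis unfolding socle_exponent_def by blast
  qed
qed

lemma associated_prime_iff_socle_exponent:
  fixes G :: "'v ugraph"
  shows "(var_ideal F :: ('v, 'k::field) mpolynomial set) \<in>
      associated_primes mpolynomial_ring (ideal_power mpolynomial_ring (edge_ideal G) t) \<longleftrightarrow>
    primeideal (var_ideal F :: ('v, 'k) mpolynomial set) mpolynomial_ring \<and>
    (\<exists>u. socle_exponent G F t u)"
  unfolding ideal_power_edge_ideal var_ideal_associated_iff[OF up_closed_edge_power_exponents]
    socle_exponent_def ..

theorem theorem4p8: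
  fixes G :: "'v::finite ugraph"
    and F :: "'v set"
    and I :: "('v, 'k::field) mpolynomial set"
  assumes "simple_graph G" and "verts G = UNIV"
    and "I = edge_ideal G"
    and "var_ideal F \<in> stable_associated_primes mpolynomial_ring I"
  shows "\<forall>t::nat. t \<ge> 1 \<longrightarrow>
           (var_ideal F \<in> associated_primes mpolynomial_ring (ideal_power mpolynomial_ring I t)
              \<longleftrightarrow> real t > s_core G F)"
proof -
  let ?C = "core G F"
  let ?H = "induced_subgraph G ?C"
  \<comment> \<open>Any power from which the sequence is constant will do.\<close>
  obtain t0 where t0: "var_ideal F \<in> associated_primes mpolynomial_ring (ideal_power mpolynomial_ring I t0)"
    using assms(4) by (auto simp: stable_associated_primes_def)
  then have prime: "primeideal (var_ideal F :: ('v, 'k) mpolynomial set) mpolynomial_ring"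
    and t0': "\<exists>u. socle_exponent G F t0 u"
    using associated_prime_iff_socle_exponent[where 'k = 'k] by (auto simp: assms(3))
  have ass_iff: "var_ideal F \<in> associated_primes mpolynomial_ring (ideal_power mpolynomial_ring I t) \<longleftrightarrow>
      (\<exists>u. socle_exponent G F t u)" for t
    using associated_prime_iff_socle_exponent[where 'k = 'k] prime by (auto simp: assms(3))
  have cover: "vertex_cover G F"
    using socle_exponent_imp_cover[OF assms(1)] t0' assms(2) by blast
  have H: "simple_graph ?H" by (rule simple_graph_induced[OF assms(1)]) (simp add: assms(2))
  define \<U> where "\<U> = {U. dominating_set ?H U \<and> strongly_non_bipartite (induced_subgraph G U)}"
  have UC: "U \<subseteq> ?C" if "U \<in> \<U>" for U
    using that by (simp add: \<U>_def dominating_set_def)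
  have induced: "induced_subgraph ?H U = induced_subgraph G U" if "dominating_set ?H U" for U
    by (rule induced_induced) (use that in \<open>simp add: dominating_set_def\<close>)
  have ex_U: "\<exists>U\<in>\<U>. mu_star (induced_subgraph G U) < real t"
    if t: "\<exists>u. socle_exponent G F t u" and "?C \<noteq> {}" for t
  proof -
    obtain s a where s: "s < t" "critical (edges ?H) ?C s a" "set_mset a \<subseteq> ?C"
      using socle_exponent_imp_critical[OF assms(1) cover] t by blast
    then obtain U where U: "dominating_set ?H U" "strongly_non_bipartite (induced_subgraph ?H U)"
      "mu_star (induced_subgraph ?H U) \<le> real s"
      using critical_imp_dominating_set[OF H, of s a] \<open>?C \<noteq> {}\<close> by auto
    then have "U \<in> \<U>" "mu_star (induced_subgraph G U) < real t"
      using s(1) unfolding \<U>_def induced[OF U(1)] by auto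
    then show ?thesis by blast
  qed
  have ex_socle: "\<exists>u. socle_exponent G F (s + 1) u"
    if hyps: "U \<in> \<U>" "mu_star (induced_subgraph G U) < real (s + 1)" "?C \<noteq> {}" for U s
  proof -
    have U: "dominating_set ?H U" "strongly_non_bipartite (induced_subgraph G U)"
      using hyps(1) by (simp_all add: \<U>_def)
    have "simple_graph (induced_subgraph G U)"
      by (rule simple_graph_induced[OF assms(1)]) (simp add: assms(2))
    \<comment> \<open>As \<mu>* is a natural number, \<open>< s + 1\<close> can be sharpened to
      \<open>\<le> s\<close>.\<close>
    then obtain s0 where "mu_star (induced_subgraph G U) = real s0"
      using mu_star_factor_critical[OF _ U(2)] by metis
    then have "mu_star (induced_subgraph ?H U) \<le> real s"
      using hyps(2) induced[OF U(1)] by simp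
    then obtain a where "critical (edges ?H) ?C s a" "set_mset a \<subseteq> ?C"
      using dominating_set_imp_critical[OF H _ U(1)] U(2) induced[OF U(1)] hyps(3) by auto
    then show ?thesis
      using critical_imp_socle_exponent[OF assms(1) cover hyps(3)] by blast
  qed
  show ?thesis
  proof (intro allI impI)
    fix t :: nat assume t: "t \<ge> 1"
    then obtain s where s: "t = s + 1" by (metis le_add_diff_inverse2)
    show "var_ideal F \<in> associated_primes mpolynomial_ring (ideal_power mpolynomial_ring I t)
        \<longleftrightarrow> real t > s_core G F"
    proof (cases "minimal_cover G F")
      case True
      then have "?C = {}" using core_empty_iff_minimal_cover[OF assms(1) cover] by simp
      then have "\<exists>u. socle_exponent G F t u"
        unfolding s by (rule core_empty_imp_socle_exponent[OF assms(1) cover])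
      moreover have "real t > s_core G F" using True t by (simp add: s_core_def)
      ultimately show ?thesis by (simp add: ass_iff)
    next
      case False
      then have C: "?C \<noteq> {}" using core_empty_iff_minimal_cover[OF assms(1) cover] by simp
      define M where "M = (\<lambda>U. mu_star (induced_subgraph G U)) ` \<U>"
      have s_core: "s_core G F = Min M"
        using False by (simp add: s_core_def M_def \<U>_def setcompr_eq_image)
      have "finite M" by (simp add: M_def)
      \<comment> \<open>The power \<open>t0\<close> supplies a dominating set, so that
        \<open>Min M\<close> is a genuine minimum.\<close>
      moreover have "M \<noteq> {}" using ex_U[OF t0' C] by (auto simp: M_def)
      ultimately have "real t > s_core G F \<longleftrightarrow> (\<exists>U\<in>\<U>. mu_star (induced_subgraph G U) < real t)"
        by (simp add: s_core Min_less_iff M_def)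
      also have "\<dots> \<longleftrightarrow> (\<exists>u. socle_exponent G F t u)"
        using ex_U[OF _ C, of t] ex_socle[OF _ _ C] unfolding s by blast
      finally show ?thesis by (simp add: ass_iff)
    qed
  qed
qed

end
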